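(* Let $n\ge 1$, $p\ge 0$, $0<\lambda\le\Lambda$ and $d>0$. There exists a constant $C=C(n,\lambda,\Lambda,p,d)>0$ such that the following holds for every bounded domain $\Omega\subset\mathbb{R}^n$ with $\operatorname{diam}(\Omega)=d$, every $f\in C(\Omega)$ and every $u\in C(\overline{\Omega})$. (i) If $$\mathcal{M}^+_{\lambda,\Lambda}\left([|D_iu|^{p/2}]\,D^2u\,[|D_iu|^{p/2}]\right)+\Lambda|Du|^{p+1}\ge f(x)\quad\text{in }\Omega$$ in the viscosity sense, then $$\sup_\Omega u\le \sup_{\partial\Omega}u^+ + C\,\|f^-\|_{L^n(\Gamma^+(u))}^{\frac{1}{1+p}} .$$ (ii) If $$\mathcal{M}^-_{\lambda,\Lambda}\left([|D_iu|^{p/2}]\,D^2u\,[|D_iu|^{p/2}]\right)-\Lambda|Du|^{p+1}\le f(x)\quad\text{in }\Omega$$ in the viscosity sense, then $$\sup_\Omega u^-\le \sup_{\partial\Omega}u^- + C\,\|f^+\|_{L^n(\Gamma^+(-u))}^{\frac{1}{1+p}} .$$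
   Context: Notation: $g^+=\max\{g,0\}$, $g^-=\max\{-g,0\}$. For $a=(a_1,\dots,a_n)\in\mathbb{R}^n$, $[a_i]=\operatorname{diag}(a_1,\dots,a_n)$ is the diagonal matrix with entries $a_i$; when $p=0$, $|s|^{p/2}$ is read as $1$ for all $s$. Pucci operators: for a symmetric real $n\times n$ matrix $M$ with eigenvalues $e_1(M),\dots,e_n(M)$, $$\mathcal{M}^+_{\lambda,\Lambda}(M)=\lambda\sum_{e_i(M)<0}e_i(M)+\Lambda\sum_{e_i(M)>0}e_i(M),\qquad \mathcal{M}^-_{\lambda,\Lambda}(M)=\Lambda\sum_{e_i(M)<0}e_i(M)+\lambda\sum_{e_i(M)>0}e_i(M).$$ Viscosity sense: let $U\subset\mathbb{R}^n$ be open, $f\in C(U)$ and $u$ continuous on $U$. We say $\mathcal{M}^-_{\lambda,\Lambda}([|D_iu|^{p/2}]D^2u[|D_iu|^{p/2}])-\Lambda|Du|^{p+1}\le f(x)$ in $U$ in the viscosity sense if, whenever $x_0\in U$ and $\psi\in C^2(U)$ are such that $u-\psi$ has a local minimum at $x_0$, one has $$\mathcal{M}^-_{\lambda,\Lambda}\left([|D_i\psi(x_0)|^{p/2}]D^2\psi(x_0)[|D_i\psi(x_0)|^{p/2}]\right)-\Lambda|D\psi(x_0)|^{p+1}\le f(x_0).$$ We say $\mathcal{M}^+_{\lambda,\Lambda}([|D_iu|^{p/2}]D^2u[|D_iu|^{p/2}])+\Lambda|Du|^{p+1}\ge f(x)$ in $U$ in the viscosity sense if, whenever $x_0\in U$ and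 $\psi\in C^2(U)$ are such that $u-\psi$ has a local maximum at $x_0$, one has $$\mathcal{M}^+_{\lambda,\Lambda}\left([|D_i\psi(x_0)|^{p/2}]D^2\psi(x_0)[|D_i\psi(x_0)|^{p/2}]\right)+\Lambda|D\psi(x_0)|^{p+1}\ge f(x_0).$$ Upper contact set: for a continuous function $u$ on $\Omega$, $$\Gamma^+(u)=\{y\in\Omega:\ \exists\,\xi\in\mathbb{R}^n\text{ such that }u(x)\le u(y)+\langle \xi,x-y\rangle\ \text{ for all }x\in\Omega\}.$$ *)

theory Defs
  imports
    "HOL-Analysis.Analysis"
    "HOL-Computational_Algebra.Polynomial"
begin

definition charpoly :: "real ^ 'n ^ 'n \<Rightarrow> real poly" where
  "charpoly M = det (mat [:0, 1:] - map_matrix (\<lambda>a. [:a:]) M)"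

text \<open>The real eigenvalues, counted with algebraic multiplicity.  For a symmetric matrix these
  are all the eigenvalues, and there are exactly \<open>CARD('n)\<close> of them.\<close>

definition eigenvalues :: "real ^ 'n ^ 'n \<Rightarrow> real multiset" where
  "eigenvalues M = proots (charpoly M)"

definition pucci_plus :: "real \<Rightarrow> real \<Rightarrow> real ^ 'n ^ 'n \<Rightarrow> real" where
  "pucci_plus l L M =
     l * (\<Sum>\<^sub># (filter_mset (\<lambda>e. e < 0) (eigenvalues M)))
   + L * (\<Sum>\<^sub># (filter_mset (\<lambda>e. e > 0) (eigenvalues M)))"

definition pucci_minus :: "real \<Rightarrow> real \<Rightarrow> real ^ 'n ^ 'n \<Rightarrow> real" where
  "pucci_minus l L M =
     L * (\<Sum>\<^sub># (filter_mset (\<lambda>e. e < 0) (eigenvalues M)))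
   + l * (\<Sum>\<^sub># (filter_mset (\<lambda>e. e > 0) (eigenvalues M)))"

definition diag :: "real ^ 'n \<Rightarrow> real ^ 'n ^ 'n" where
  "diag a = (\<chi> i j. if i = j then a $ i else 0)"

text \<open>The case \<open>p = 0\<close> is separate because \<open>0 powr 0 = 0\<close>, whereas the convention here is
  that \<open>\<bar>s\<bar>\<close> to the power \<open>0\<close> is \<open>1\<close> for every \<open>s\<close>.\<close>

definition half_pow :: "real \<Rightarrow> real \<Rightarrow> real" where
  "half_pow p s = (if p = 0 then 1 else \<bar>s\<bar> powr (p / 2))"

text \<open>The matrix \<open>[|q_i|^(p/2)] H [|q_i|^(p/2)]\<close> for a gradient \<open>q\<close> and a Hessian \<open>H\<close>.\<close>

definition weighted_hessian :: "real \<Rightarrow> real ^ 'n \<Rightarrow> real ^ 'n ^ 'n \<Rightarrow> real ^ 'n ^ 'n" where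
  "weighted_hessian p q H =
     diag (\<chi> i. half_pow p (q $ i)) ** H ** diag (\<chi> i. half_pow p (q $ i))"

text \<open>\<open>psi\<close> is twice continuously differentiable on the open set \<open>U\<close>, with gradient \<open>G\<close> and
  Hessian \<open>H\<close> there (these are uniquely determined on \<open>U\<close>).\<close>

definition C2_on ::
  "(real ^ 'n) set \<Rightarrow> (real ^ 'n \<Rightarrow> real) \<Rightarrow> (real ^ 'n \<Rightarrow> real ^ 'n) \<Rightarrow> (real ^ 'n \<Rightarrow> real ^ 'n ^ 'n) \<Rightarrow> bool"
where
  "C2_on U psi G H \<longleftrightarrow>
     (\<forall>x\<in>U. GDERIV psi x :> G x) \<and>
     (\<forall>x\<in>U. (G has_derivative (\<lambda>h. H x *v h)) (at x)) \<and>
     continuous_on U H"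

text \<open>For \<open>x0\<close> in an open \<open>U\<close>, \<open>nhds x0\<close> is the same as the filter of neighbourhoods within \<open>U\<close>.\<close>

definition local_min_at :: "(real ^ 'n \<Rightarrow> real) \<Rightarrow> real ^ 'n \<Rightarrow> bool" where
  "local_min_at g x0 \<longleftrightarrow> (\<forall>\<^sub>F x in nhds x0. g x0 \<le> g x)"

definition local_max_at :: "(real ^ 'n \<Rightarrow> real) \<Rightarrow> real ^ 'n \<Rightarrow> bool" where
  "local_max_at g x0 \<longleftrightarrow> (\<forall>\<^sub>F x in nhds x0. g x \<le> g x0)"

definition visc_minus_le ::
  "real \<Rightarrow> real \<Rightarrow> real \<Rightarrow> (real ^ 'n) set \<Rightarrow> (real ^ 'n \<Rightarrow> real) \<Rightarrow> (real ^ 'n \<Rightarrow> real) \<Rightarrow> bool"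
where
  "visc_minus_le p l L U f u \<longleftrightarrow>
     (\<forall>x0\<in>U. \<forall>psi G H. C2_on U psi G H \<longrightarrow> local_min_at (\<lambda>x. u x - psi x) x0 \<longrightarrow>
        pucci_minus l L (weighted_hessian p (G x0) (H x0)) - L * norm (G x0) powr (p + 1) \<le> f x0)"

definition visc_plus_ge ::
  "real \<Rightarrow> real \<Rightarrow> real \<Rightarrow> (real ^ 'n) set \<Rightarrow> (real ^ 'n \<Rightarrow> real) \<Rightarrow> (real ^ 'n \<Rightarrow> real) \<Rightarrow> bool"
where
  "visc_plus_ge p l L U f u \<longleftrightarrow>
     (\<forall>x0\<in>U. \<forall>psi G H. C2_on U psi G H \<longrightarrow> local_max_at (\<lambda>x. u x - psi x) x0 \<longrightarrow>
        pucci_plus l L (weighted_hessian p (G x0) (H x0)) + L * norm (G x0) powr (p + 1) \<ge> f x0)"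

definition upper_contact_set :: "(real ^ 'n) set \<Rightarrow> (real ^ 'n \<Rightarrow> real) \<Rightarrow> (real ^ 'n) set" where
  "upper_contact_set U u = {y \<in> U. \<exists>xi. \<forall>x\<in>U. u x \<le> u y + xi \<bullet> (x - y)}"

text \<open>Real powers on \<open>[0, \<infinity>]\<close>, for positive exponents.\<close>

definition ennreal_powr :: "ennreal \<Rightarrow> real \<Rightarrow> ennreal" where
  "ennreal_powr x a = (if x = \<infinity> then \<infinity> else ennreal (enn2real x powr a))"

text \<open>The norm is extended-valued: \<open>f\<close> is merely continuous on the open set \<open>\<Omega>\<close>, so it may be
  unbounded and fail to be in \<open>L^n\<close>.\<close>

definition Lnorm :: "real \<Rightarrow> 'a::euclidean_space set \<Rightarrow> ('a \<Rightarrow> real) \<Rightarrow> ennreal" where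
  "Lnorm q A g = ennreal_powr (\<integral>\<^sup>+x\<in>A. ennreal (\<bar>g x\<bar> powr q) \<partial>lborel) (1 / q)"

definition pos_part :: "('a \<Rightarrow> real) \<Rightarrow> 'a \<Rightarrow> real" where
  "pos_part g x = max (g x) 0"

definition neg_part :: "('a \<Rightarrow> real) \<Rightarrow> 'a \<Rightarrow> real" where
  "neg_part g x = max (- g x) 0"

end

theory Submission
  imports Defs
begin

text \<open>
  Only slopes in the cubes \<open>[r, 2r]\<^sup>n\<close> are used.  There the weights \<open>\<bar>D\<^sub>i u\<bar>\<^sup>p\<close> are all comparable to
  \<open>r\<^sup>p\<close>, so the operator is uniformly elliptic up to the factor \<open>r\<^sup>p\<close>.  If two points at distance at
  most \<open>\<rho>\<close> carry supporting planes whose slopes differ too much, the minimum of the two planes lies far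
  below the first one on one side, and a quadratic barrier that is very concave in the direction of the
  difference of the slopes contradicts the viscosity inequality.  Hence the slope is a locally Lipschitz
  function of the contact point, with constant \<open>C (f\<^sup>- / r\<^sup>p + r)\<close>, and a covering by dyadic cubes bounds the
  measure \<open>r\<^sup>n\<close> of the set of slopes by \<open>C \<integral> (f\<^sup>- / r\<^sup>p + r)\<^sup>n\<close> over the contact points \<open>\<Gamma>\<^sub>r\<close> with slope in the
  cube.  No second differentiability of the concave envelope is needed.

  The term \<open>C r\<^sup>n \<bar>\<Gamma>\<^sub>r\<bar>\<close> coming from the gradient is absorbed by a pigeonhole argument: for
  \<open>r = R / 4\<^sup>k\<close> with \<open>k < N\<close> the sets \<open>\<Gamma>\<^sub>r\<close> are disjoint, so for one of them \<open>C \<bar>\<Gamma>\<^sub>r\<bar> \<le> 1/2\<close>.  This bounds \<open>R\<close>,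
  which may be any number small compared to \<open>(sup u - M) / d\<close>, where \<open>M\<close> is the supremum of \<open>u\<^sup>+\<close> on
  the boundary.
\<close>

section \<open>Eigenvalues and Pucci operators\<close>

lemma poly_det: "poly (det P) x = det (map_matrix (\<lambda>q. poly q x) P)"
  for P :: "'a::comm_ring_1 poly ^ 'n ^ 'n"
  by (simp add: det_def poly_sum poly_prod)

lemma poly_charpoly: "poly (charpoly M) x = det (mat x - M)"
  unfolding charpoly_def poly_det
  by (rule arg_cong[where f = det]) (simp add: vec_eq_iff mat_def)

lemma degree_charpoly_le: "degree (charpoly M) \<le> CARD('n)"
  for M :: "real ^ 'n ^ 'n"
  unfolding charpoly_def det_def
proof (intro degree_sum_le)
  fix s :: "'n \<Rightarrow> 'n"
  let ?B = "mat [:0, 1:] - map_matrix (\<lambda>a. [:a:]) M"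
  have entry: "degree (?B $ i $ j) \<le> 1" for i j
    by (cases "i = j") (simp_all add: mat_def)
  have "degree (of_int (sign s) * (\<Prod>i\<in>UNIV. ?B $ i $ s i))
      \<le> degree (of_int (sign s) :: real poly) + degree (\<Prod>i\<in>UNIV. ?B $ i $ s i)"
    by (rule degree_mult_le)
  also have "degree (\<Prod>i\<in>UNIV. ?B $ i $ s i) \<le> (\<Sum>i\<in>UNIV. degree (?B $ i $ s i))"
    using degree_prod_sum_le[of UNIV "\<lambda>i. ?B $ i $ s i"] by (simp add: o_def)
  also have "\<dots> \<le> (\<Sum>i\<in>(UNIV::'n set). 1)"
    by (intro sum_mono entry)
  finally show "degree (of_int (sign s) * (\<Prod>i\<in>UNIV. ?B $ i $ s i)) \<le> CARD('n)"
    by simp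
qed simp

lemma mat_mult_vec: "mat c *v v = c *\<^sub>R v" for v :: "real ^ 'n"
  by (simp add: vec_eq_iff mat_def matrix_vector_mult_def if_distrib[where f = "\<lambda>x. x * _"] cong: if_cong)

lemma charpoly_root_iff:
  "poly (charpoly M) x = 0 \<longleftrightarrow> (\<exists>v. v \<noteq> 0 \<and> M *v v = x *\<^sub>R v)"
  for M :: "real ^ 'n ^ 'n"
proof -
  have "poly (charpoly M) x = 0 \<longleftrightarrow> (\<exists>v. (mat x - M) *v v = 0 \<and> v \<noteq> 0)"
    using invertible_det_nz[of "mat x - M"] matrix_left_invertible_ker[of "mat x - M"]
    by (auto simp: poly_charpoly invertible_left_inverse)
  then show ?thesis
    by (simp add: matrix_vector_mult_diff_rdistrib mat_mult_vec) metis
qed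

text \<open>A real number above the operator norm of \<open>M\<close> is not an eigenvalue, so there
  is a point where the polynomial does not vanish.\<close>

lemma charpoly_nonzero: "charpoly M \<noteq> 0" for M :: "real ^ 'n ^ 'n"
proof
  assume "charpoly M = 0"
  define x where "x = onorm ((*v) M) + 1"
  obtain v where v: "v \<noteq> 0" "M *v v = x *\<^sub>R v"
    using \<open>charpoly M = 0\<close> charpoly_root_iff[of M x] by auto
  have bl: "bounded_linear ((*v) M)" by simp
  have "\<bar>x\<bar> * norm v \<le> onorm ((*v) M) * norm v"
    using onorm[OF bl, of v] v(2) by simp
  with v(1) onorm_pos_le[OF bl] show False by (simp add: x_def)
qed

lemma in_eigenvalues_iff:
  "e \<in># eigenvalues M \<longleftrightarrow> (\<exists>v. v \<noteq> 0 \<and> M *v v = e *\<^sub>R v)"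
  for M :: "real ^ 'n ^ 'n"
  by (simp add: eigenvalues_def charpoly_nonzero charpoly_root_iff)

lemma size_eigenvalues_le: "size (eigenvalues M) \<le> CARD('n)"
  for M :: "real ^ 'n ^ 'n"
  unfolding eigenvalues_def
  by (rule order_trans[OF size_proots_le degree_charpoly_le])

text \<open>Induction on the degree: a real root \<open>a\<close> of \<open>q\<close> is split off
  as a linear factor and becomes the root \<open>-a\<close> of the composition; if \<open>q\<close>
  has no real root, both multisets are empty.\<close>

lemma proots_pcompose_uminus:
  fixes q :: "real poly"
  assumes "q \<noteq> 0"
  shows "proots (q \<circ>\<^sub>p [:0, -1:]) = image_mset uminus (proots q)"
  using assms
proof (induction "degree q" arbitrary: q rule: less_induct)
  case less
  show ?case
  proof (cases "\<exists>a. poly q a = 0")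
    case False
    have "q \<circ>\<^sub>p [:0, -1:] \<noteq> 0"
      using False by (metis poly_0 poly_pcompose)
    then have "proots (q \<circ>\<^sub>p [:0, -1:]) = {#}"
      using False by (intro multiset_eqI) (simp add: order_0I poly_pcompose)
    moreover have "proots q = {#}"
      using False less.prems by (intro multiset_eqI) (simp add: order_0I)
    ultimately show ?thesis by simp
  next
    case True
    then obtain a r where q: "q = [:-a, 1:] * r"
      by (metis dvdE poly_eq_0_iff_dvd)
    with less.prems have r: "r \<noteq> 0" by auto
    have IH: "proots (r \<circ>\<^sub>p [:0, -1:]) = image_mset uminus (proots r)"
      by (rule less.hyps) (use r in \<open>simp_all add: q degree_mult_eq del: mult_pCons_left\<close>)
    have r': "r \<circ>\<^sub>p [:0, -1:] \<noteq> 0"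
      using r by (simp add: pcompose_eq_0_iff)
    have "[:-a, 1:] \<circ>\<^sub>p [:0, -1:] = - [:a, 1:]"
      by (simp add: pcompose_pCons)
    then have "q \<circ>\<^sub>p [:0, -1:] = - ([:a, 1:] * (r \<circ>\<^sub>p [:0, -1:]))"
      unfolding q pcompose_mult by (simp only: mult_minus_left)
    then have "proots (q \<circ>\<^sub>p [:0, -1:]) = add_mset (-a) (proots (r \<circ>\<^sub>p [:0, -1:]))"
      using r' by (simp only: proots_uminus) (subst proots_mult, simp_all)
    moreover have "proots q = add_mset a (proots r)"
      unfolding q using r by (subst proots_mult) simp_all
    ultimately show ?thesis by (simp add: IH)
  qed
qed

lemma charpoly_uminus:
  "charpoly (- M) = smult ((-1) ^ CARD('n)) (charpoly M \<circ>\<^sub>p [:0, -1:])"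
  for M :: "real ^ 'n ^ 'n"
proof (rule poly_eq_poly_eq_iff[THEN iffD1])
  show "poly (charpoly (- M)) = poly (smult ((-1) ^ CARD('n)) (charpoly M \<circ>\<^sub>p [:0, -1:]))"
  proof
    fix x
    define N where "N = mat (- x) - M"
    have "mat x - - M = (\<chi> i. (- 1) *s (N $ i))" "N = (\<chi> i. N $ i)"
      by (simp_all add: vec_eq_iff mat_def N_def)
    then have "det (mat x - - M) = (-1) ^ CARD('n) * det N"
      using det_rows_mul[of "\<lambda>_. - 1" "\<lambda>i. N $ i"] by simp
    then have "det (mat x - - M) = (-1) ^ CARD('n) * det (mat (- x) - M)"
      by (simp only: N_def)
    then show "poly (charpoly (- M)) x = poly (smult ((-1) ^ CARD('n)) (charpoly M \<circ>\<^sub>p [:0, -1:])) x"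
      by (simp add: poly_charpoly poly_pcompose)
  qed
qed

lemma eigenvalues_uminus: "eigenvalues (- M) = image_mset uminus (eigenvalues M)"
  for M :: "real ^ 'n ^ 'n"
  by (simp add: eigenvalues_def charpoly_uminus proots_pcompose_uminus charpoly_nonzero)

text \<open>Together with a sign change of the test function this duality reduces part (ii) of the
  theorem to part (i).\<close>

lemma pucci_minus_uminus: "pucci_minus l L (- M) = - pucci_plus l L M"
  for M :: "real ^ 'n ^ 'n"
proof -
  have neg: "\<Sum>\<^sub># (image_mset uminus A) = - \<Sum>\<^sub># A" for A :: "real multiset"
    by (induction A) auto
  show ?thesis
    by (simp add: pucci_minus_def pucci_plus_def eigenvalues_uminus filter_mset_image_mset neg)
qed

text \<open>The minimum \<open>m\<close> of the quadratic form on the unit sphere is an eigenvalue.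
  For a minimizer \<open>v\<close>, the matrix \<open>B = M - mat m\<close> is positive semidefinite
  and its form vanishes at \<open>v\<close>; moving from \<open>v\<close> along
  \<open>B *v v\<close> could make the form negative unless \<open>B *v v = 0\<close>.\<close>

lemma Rayleigh_quotient_ge_eigenvalue:
  fixes M :: "real ^ 'n ^ 'n"
  assumes sym: "transpose M = M" and w: "norm w = 1"
  obtains e where "e \<in># eigenvalues M" "e \<le> w \<bullet> (M *v w)"
proof -
  have "continuous_on (sphere 0 1) (\<lambda>v. v \<bullet> (M *v v))"
    by (intro continuous_intros)
  moreover have "w \<in> sphere 0 1" using w by simp
  ultimately obtain v where v: "norm v = 1"
      and min: "\<And>z. norm z = 1 \<Longrightarrow> v \<bullet> (M *v v) \<le> z \<bullet> (M *v z)"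
    using continuous_attains_inf[of "sphere 0 1" "\<lambda>v. v \<bullet> (M *v v)"] by fastforce
  define m where "m = v \<bullet> (M *v v)"
  define B where "B = M - mat m"
  have Bv: "B *v z = M *v z - m *\<^sub>R z" for z
    by (simp add: B_def matrix_vector_mult_diff_rdistrib mat_mult_vec)
  have M_sym: "x \<bullet> (M *v y) = y \<bullet> (M *v x)" for x y
    by (metis dot_lmul_matrix inner_commute sym vector_transpose_matrix)
  have B_sym: "x \<bullet> (B *v y) = y \<bullet> (B *v x)" for x y
    by (simp add: Bv inner_diff_right M_sym[of x y] inner_commute)
  have B_nonneg: "0 \<le> z \<bullet> (B *v z)" for z
  proof (cases "z = 0")
    case False
    have "m \<le> (z /\<^sub>R norm z) \<bullet> (M *v (z /\<^sub>R norm z))"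
      unfolding m_def using False by (intro min) simp
    also have "\<dots> = (z \<bullet> (M *v z)) / (norm z)\<^sup>2"
      by (simp add: matrix_vector_mult_scaleR power2_eq_square divide_inverse)
    finally have "m * (norm z)\<^sup>2 \<le> z \<bullet> (M *v z)"
      using False by (simp add: field_simps)
    then show ?thesis by (simp add: Bv inner_diff_right power2_norm_eq_inner)
  qed simp
  have Bvv: "v \<bullet> (B *v v) = 0"
    using v by (simp add: Bv inner_diff_right m_def flip: power2_norm_eq_inner)
  define z where "z = B *v v"
  define c where "c = z \<bullet> (B *v z)"
  have quad: "0 \<le> 2 * t * (norm z)\<^sup>2 + t\<^sup>2 * c" for t
  proof -
    have "0 \<le> (v + t *\<^sub>R z) \<bullet> (B *v (v + t *\<^sub>R z))" by (rule B_nonneg)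
    also have "\<dots> = v \<bullet> (B *v v) + 2 * t * (z \<bullet> (B *v v)) + t\<^sup>2 * c"
      by (simp add: matrix_vector_right_distrib matrix_vector_mult_scaleR inner_add_left
          inner_add_right B_sym[of v z] c_def power2_eq_square algebra_simps)
    also have "\<dots> = 2 * t * (norm z)\<^sup>2 + t\<^sup>2 * c"
      by (simp add: Bvv z_def power2_norm_eq_inner)
    finally show ?thesis .
  qed
  have c: "0 \<le> c" by (simp add: c_def B_nonneg)
  have "z = 0"
  proof (rule ccontr)
    assume "z \<noteq> 0"
    then have N: "(norm z)\<^sup>2 > 0" by simp
    \<comment> \<open>With this \<open>t\<close> the negative linear term outweighs the quadratic
      one; the \<open>+ 1\<close> keeps the denominator positive when \<open>c = 0\<close>.\<close>
    define t where "t = - (norm z)\<^sup>2 / (c + 1)"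
    have "t\<^sup>2 * c \<le> t\<^sup>2 * (c + 1)" by (simp add: mult_left_mono)
    also have "\<dots> = - t * (norm z)\<^sup>2"
      using c by (simp add: t_def power2_eq_square)
    finally have "0 \<le> t * (norm z)\<^sup>2" using quad[of t] by linarith
    moreover have "t < 0" using N c by (simp add: t_def divide_neg_pos)
    ultimately show False using N by (simp add: zero_le_mult_iff)
  qed
  then have "M *v v = m *\<^sub>R v" by (simp add: z_def Bv)
  then have "m \<in># eigenvalues M"
    using v by (auto simp: in_eigenvalues_iff intro!: exI[of _ v])
  moreover have "m \<le> w \<bullet> (M *v w)" unfolding m_def by (rule min[OF w])
  ultimately show thesis by (rule that)
qed

text \<open>The Rayleigh quotient at \<open>w\<close> forces an eigenvalue at most
  \<open>-a\<close>, and the other negative eigenvalues only lower the sum. Each positive eigenvalue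
  is at most \<open>b\<close>, as its eigenvector shows, and there are at most
  \<open>CARD('n)\<close> of them.\<close>

lemma pucci_plus_le:
  fixes M :: "real ^ 'n ^ 'n" and l L a b :: real
  assumes l: "0 \<le> l" and L: "0 \<le> L" and sym: "transpose M = M"
    and upper: "\<And>x. x \<bullet> (M *v x) \<le> b * (norm x)\<^sup>2" and b: "0 \<le> b"
    and w: "norm w = 1" "w \<bullet> (M *v w) \<le> - a" and a: "0 < a"
  shows "pucci_plus l L M \<le> - l * a + L * CARD('n) * b"
proof -
  let ?N = "filter_mset (\<lambda>e. e < 0) (eigenvalues M)"
  let ?P = "filter_mset (\<lambda>e. e > 0) (eigenvalues M)"
  obtain e where e: "e \<in># eigenvalues M" "e \<le> w \<bullet> (M *v w)"
    by (rule Rayleigh_quotient_ge_eigenvalue[OF sym w(1)])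
  with w(2) have e_le: "e \<le> - a" by linarith
  with e a have "e \<in># ?N" by simp
  then obtain N' where N': "?N = add_mset e N'" by (metis multi_member_split)
  have "\<Sum>\<^sub># N' \<le> 0"
  proof -
    have "x < 0" if "x \<in># N'" for x
    proof -
      have "x \<in># ?N" using that by (simp add: N')
      then show ?thesis by simp
    qed
    then show ?thesis by (induction N') (auto simp: add_nonpos_nonpos less_imp_le)
  qed
  then have neg: "\<Sum>\<^sub># ?N \<le> - a" using e_le by (simp add: N')
  have le_b: "x \<le> b" if "x \<in># ?P" for x
  proof -
    from that obtain v where v: "v \<noteq> 0" "M *v v = x *\<^sub>R v"
      by (auto simp: in_eigenvalues_iff)
    then have "x * (norm v)\<^sup>2 \<le> b * (norm v)\<^sup>2"
      using upper[of v] by (simp add: power2_norm_eq_inner)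
    then show ?thesis using v(1) by (simp add: mult_le_cancel_right)
  qed
  have "\<Sum>\<^sub># ?P \<le> real (size ?P) * b"
  proof -
    have "\<Sum>\<^sub># A \<le> real (size A) * b" if "\<And>x. x \<in># A \<Longrightarrow> x \<le> b" for A :: "real multiset"
      using that
    proof (induction A)
      case (add y A)
      have "y \<le> b" "\<Sum>\<^sub># A \<le> real (size A) * b"
        using add by simp_all
      then show ?case by (simp add: algebra_simps)
    qed simp
    from this[OF le_b] show ?thesis .
  qed
  also have "\<dots> \<le> CARD('n) * b"
    using order_trans[OF size_filter_mset_lesseq size_eigenvalues_le] b
    by (intro mult_right_mono) auto
  finally have "L * \<Sum>\<^sub># ?P \<le> L * CARD('n) * b"
    using L by (simp add: mult_left_mono mult.assoc)
  moreover have "l * \<Sum>\<^sub># ?N \<le> - l * a"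
    using mult_left_mono[OF neg l] by simp
  ultimately show ?thesis by (simp add: pucci_plus_def)
qed

section \<open>Measure of the image of a locally Lipschitz relation\<close>

lemma borel_measurable_ennreal_indicator:
  fixes g :: "'a::euclidean_space \<Rightarrow> real"
  assumes "continuous_on S g" "S \<in> sets borel"
  shows "(\<lambda>x. ennreal (g x) * indicator S x) \<in> borel_measurable lborel"
proof -
  have "(\<lambda>x. indicator S x *\<^sub>R g x) \<in> borel_measurable borel"
    using assms by (intro borel_measurable_continuous_on_indicator)
  then have "(\<lambda>x. ennreal (indicator S x *\<^sub>R g x)) \<in> borel_measurable lborel"
    by simp
  also have "(\<lambda>x. ennreal (indicator S x *\<^sub>R g x)) = (\<lambda>x. ennreal (g x) * indicator S x)"
    by (auto simp: indicator_def fun_eq_iff)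
  finally show ?thesis .
qed

text \<open>A covering argument in the role of the area formula; \<open>P\<close> will relate
  contact points to slopes. \<open>S\<close> is covered by countably many cubes with disjoint
  interiors, each tagged by a point \<open>y\<close> of \<open>S\<close> around which values of
  \<open>P\<close> vary at rate at most \<open>g y\<close>. The values over a cube of side
  \<open>s\<close> lie in a cube of side \<open>2 * sqrt n * g y * s\<close>, and a further factor 2
  pays for replacing \<open>g y\<close> by \<open>g x\<close> under the integral.\<close>

lemma emeasure_le_nn_integral_open:
  fixes S V :: "'a::euclidean_space set" and P :: "'a \<Rightarrow> 'a \<Rightarrow> bool"
  assumes "bounded S" "S \<subseteq> V" "open V"
    and g: "continuous_on V g" "\<And>x. x \<in> V \<Longrightarrow> 0 < g x"
    and T: "\<And>\<xi>. \<xi> \<in> T \<Longrightarrow> \<exists>y\<in>S. P y \<xi>"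
    and ex: "\<And>y. y \<in> S \<Longrightarrow> \<exists>\<xi>. P y \<xi>"
    and loc: "\<And>y. y \<in> S \<Longrightarrow> \<exists>\<delta>>0. \<forall>\<rho> z \<xi> \<zeta>. 0 < \<rho> \<longrightarrow> \<rho> < \<delta> \<longrightarrow> z \<in> S \<longrightarrow>
      dist y z \<le> \<rho> \<longrightarrow> P y \<xi> \<longrightarrow> P z \<zeta> \<longrightarrow> dist \<xi> \<zeta> \<le> \<rho> * g y"
  shows "emeasure lborel T \<le>
    ennreal ((4 * sqrt DIM('a)) ^ DIM('a)) * (\<integral>\<^sup>+x\<in>V. ennreal (g x ^ DIM('a)) \<partial>lborel)"
proof -
  define n where "n = DIM('a)"
  have n: "n > 0" by (simp add: n_def)
  define c where "c = sqrt n"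
  have c: "c \<ge> 1" using n by (simp add: c_def)
  \<comment> \<open>The radius is small enough for \<open>g y \<le> 2 * g x\<close> on the ball and
    for the Lipschitz bound to apply up to distance \<open>2 * c * \<epsilon>\<close>, which is at
    least the diameter of any cube inside the ball.\<close>
  define Q where "Q y \<epsilon> \<longleftrightarrow> \<epsilon> > 0 \<and> ball y \<epsilon> \<subseteq> V \<and> (\<forall>x\<in>ball y \<epsilon>. g y \<le> 2 * g x) \<and>
      (\<forall>\<rho> z \<xi> \<zeta>. 0 < \<rho> \<longrightarrow> \<rho> \<le> 2 * c * \<epsilon> \<longrightarrow> z \<in> S \<longrightarrow>
         dist y z \<le> \<rho> \<longrightarrow> P y \<xi> \<longrightarrow> P z \<zeta> \<longrightarrow> dist \<xi> \<zeta> \<le> \<rho> * g y)" for y \<epsilon>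
  have "\<exists>\<epsilon>. Q y \<epsilon>" if y: "y \<in> S" for y
  proof -
    from y \<open>S \<subseteq> V\<close> have yV: "y \<in> V" by blast
    obtain \<delta> where \<delta>: "\<delta> > 0" "\<And>\<rho> z \<xi> \<zeta>. \<lbrakk>0 < \<rho>; \<rho> < \<delta>; z \<in> S; dist y z \<le> \<rho>; P y \<xi>; P z \<zeta>\<rbrakk>
        \<Longrightarrow> dist \<xi> \<zeta> \<le> \<rho> * g y"
      using loc[OF y] by blast
    obtain \<epsilon>1 where e1: "\<epsilon>1 > 0" "ball y \<epsilon>1 \<subseteq> V"
      using \<open>open V\<close> yV open_contains_ball by blast
    have gy: "g y > 0" using g(2)[OF yV] .
    then obtain \<epsilon>2 where e2: "\<epsilon>2 > 0" "\<And>x. x \<in> V \<Longrightarrow> dist x y < \<epsilon>2 \<Longrightarrow> dist (g x) (g y) < g y / 2"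
      using g(1) yV unfolding continuous_on_iff by (metis half_gt_zero)
    define \<epsilon> where "\<epsilon> = Min {\<epsilon>1, \<epsilon>2, \<delta> / (4 * c)}"
    have \<epsilon>: "\<epsilon> > 0" "\<epsilon> \<le> \<epsilon>1" "\<epsilon> \<le> \<epsilon>2" "\<epsilon> \<le> \<delta> / (4 * c)"
      using e1 e2 \<delta>(1) c by (auto simp: \<epsilon>_def)
    have "2 * c * \<epsilon> \<le> \<delta> / 2"
      using mult_left_mono[OF \<epsilon>(4), of "2 * c"] c by (simp add: field_simps)
    then have lt: "\<rho> \<le> 2 * c * \<epsilon> \<Longrightarrow> \<rho> < \<delta>" for \<rho> using \<delta>(1) by linarith
    have sub: "ball y \<epsilon> \<subseteq> V" using e1(2) \<epsilon>(2) by (meson subset_ball subset_trans)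
    have "g y \<le> 2 * g x" if "x \<in> ball y \<epsilon>" for x
    proof -
      have "x \<in> V" "dist x y < \<epsilon>2" using that sub \<epsilon>(3) by (auto simp: dist_commute)
      from e2(2)[OF this] show ?thesis by (simp add: dist_real_def abs_if split: if_splits)
    qed
    with \<epsilon>(1) sub \<delta>(2) lt show ?thesis unfolding Q_def by blast
  qed
  then obtain \<epsilon> where \<epsilon>_Q: "\<And>y. y \<in> S \<Longrightarrow> Q y (\<epsilon> y)" by metis
  have \<epsilon>: "\<And>y. y \<in> S \<Longrightarrow> \<epsilon> y > 0" "\<And>y. y \<in> S \<Longrightarrow> ball y (\<epsilon> y) \<subseteq> V"
      "\<And>y x. \<lbrakk>y \<in> S; x \<in> ball y (\<epsilon> y)\<rbrakk> \<Longrightarrow> g y \<le> 2 * g x"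
      "\<And>y \<rho> z \<xi> \<zeta>. \<lbrakk>y \<in> S; 0 < \<rho>; \<rho> \<le> 2 * c * \<epsilon> y; z \<in> S; dist y z \<le> \<rho>; P y \<xi>; P z \<zeta>\<rbrakk>
        \<Longrightarrow> dist \<xi> \<zeta> \<le> \<rho> * g y"
    using \<epsilon>_Q unfolding Q_def by blast+
  obtain B where B: "B > 0" "S \<subseteq> cbox (- (B *\<^sub>R One)) (B *\<^sub>R One)"
  proof -
    obtain B where "0 < B" "\<forall>x\<in>S. norm x \<le> B"
      using \<open>bounded S\<close> bounded_pos by blast
    then have "- B \<le> x \<bullet> i \<and> x \<bullet> i \<le> B" if "x \<in> S" "i \<in> Basis" for x i
      using Basis_le_norm[OF that(2), of x] that(1) by force
    then have "S \<subseteq> cbox (- (B *\<^sub>R One)) (B *\<^sub>R One)"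
      by (auto simp: mem_box)
    with \<open>0 < B\<close> show ?thesis by (rule that)
  qed
  have box_ne: "box (- (B *\<^sub>R One)) (B *\<^sub>R One) \<noteq> ({} :: 'a set)"
    using B(1) by (simp add: box_ne_empty)
  \<comment> \<open>A gauge must be defined on the whole space; \<open>UNIV\<close> is the default
    off \<open>S\<close>, where no tags are taken.\<close>
  define \<gamma> where "\<gamma> y = (if y \<in> S then ball y (\<epsilon> y) else UNIV)" for y
  have "gauge \<gamma>" using \<epsilon>(1) by (auto simp: gauge_def \<gamma>_def)
  from covering_lemma[OF B(2) box_ne this] obtain \<D> where
    cnt: "countable \<D>"
    and D: "\<And>K. K \<in> \<D> \<Longrightarrow> interior K \<noteq> {} \<and> (\<exists>c d. K = cbox c d)"
    and disj: "pairwise (\<lambda>A B. interior A \<inter> interior B = {}) \<D>"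
    and tag: "\<And>K. K \<in> \<D> \<Longrightarrow> \<exists>x\<in>S \<inter> K. K \<subseteq> \<gamma> x"
    and side: "\<And>u v. cbox u v \<in> \<D> \<Longrightarrow>
      \<exists>m. \<forall>i\<in>Basis. v \<bullet> i - u \<bullet> i = ((B *\<^sub>R One) \<bullet> i - (- (B *\<^sub>R One)) \<bullet> i) / 2 ^ m"
    and cov: "S \<subseteq> \<Union>\<D>"
    by metis
  define h where "h x = indicator V x * ennreal (g x ^ n)" for x
  have h_meas: "h \<in> borel_measurable lborel"
  proof -
    have "(\<lambda>x. ennreal (g x ^ n) * indicator V x) \<in> borel_measurable lborel"
      using \<open>open V\<close> g(1) by (intro borel_measurable_ennreal_indicator continuous_intros) auto
    then show ?thesis by (simp add: h_def[abs_def] mult.commute)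
  qed
  have piece: "\<exists>A\<in>sets lborel. (\<forall>\<xi> z. z \<in> S \<inter> K \<longrightarrow> P z \<xi> \<longrightarrow> \<xi> \<in> A) \<and>
      emeasure lborel A \<le> ennreal ((4 * c) ^ n) * (\<integral>\<^sup>+x\<in>interior K. h x \<partial>lborel)" if K: "K \<in> \<D>" for K
  proof -
    obtain u v where Kuv: "K = cbox u v" using D[OF K] by blast
    obtain m where m: "\<And>i. i \<in> Basis \<Longrightarrow> v \<bullet> i - u \<bullet> i = 2 * B / 2 ^ m"
      using side[of u v] K Kuv by (auto simp: inner_simps)
    define s where "s = 2 * B / 2 ^ m"
    have s: "s > 0" using B(1) by (simp add: s_def)
    have vi: "v \<bullet> i = u \<bullet> i + s" if "i \<in> Basis" for i
      using m[OF that] by (simp add: s_def)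
    have vu: "v - u = s *\<^sub>R One"
    proof (rule euclidean_eqI)
      fix i :: 'a assume "i \<in> Basis"
      then show "(v - u) \<bullet> i = (s *\<^sub>R One) \<bullet> i" by (simp add: vi inner_diff_left)
    qed
    obtain y where y: "y \<in> S" "y \<in> K" "K \<subseteq> ball y (\<epsilon> y)"
      using tag[OF K] by (auto simp: \<gamma>_def)
    obtain \<xi>0 where \<xi>0: "P y \<xi>0" using ex[OF y(1)] by blast
    have norm_One: "norm (One :: 'a) = c"
      by (simp add: c_def n_def norm_eq_sqrt_inner inner_sum_left inner_sum_right inner_Basis if_distrib cong: if_cong)
    \<comment> \<open>The length of the diagonal of \<open>K\<close>, hence a bound for the distance
      from \<open>y\<close> to any point of \<open>K\<close>.\<close>
    define \<rho> where "\<rho> = s * c"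
    have \<rho>: "\<rho> > 0" using s c by (simp add: \<rho>_def)
    have dist_uv: "dist u v = \<rho>"
      using s norm_One by (simp add: dist_norm norm_minus_commute[of u] vu \<rho>_def)
    have uv_in: "u \<in> K" "v \<in> K"
      using vi s by (auto simp: Kuv mem_box)
    have "dist u v \<le> dist y u + dist y v" by (metis dist_commute dist_triangle)
    also have "\<dots> < 2 * \<epsilon> y"
    proof -
      have "u \<in> ball y (\<epsilon> y)" "v \<in> ball y (\<epsilon> y)" using uv_in y(3) by blast+
      then show ?thesis by simp
    qed
    also have "\<dots> \<le> 2 * c * \<epsilon> y" using c \<epsilon>(1)[OF y(1)] by simp
    finally have \<rho>_le: "\<rho> \<le> 2 * c * \<epsilon> y" using dist_uv by simp
    have dist_K: "dist y z \<le> \<rho>" if "z \<in> K" for z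
    proof -
      have "dist y z \<le> diameter K"
        by (rule diameter_bounded_bound) (use that y in \<open>auto simp: Kuv\<close>)
      also have "\<dots> = dist u v"
        unfolding Kuv using vi s by (intro diameter_cbox) auto
      finally show ?thesis by (simp add: dist_uv)
    qed
    have gy: "g y > 0" using g(2) y(1) \<open>S \<subseteq> V\<close> by blast
    define r where "r = \<rho> * g y"
    have r: "r > 0" using \<rho> gy by (simp add: r_def)
    define A where "A = cbox (\<xi>0 - r *\<^sub>R One) (\<xi>0 + r *\<^sub>R One)"
    have "\<xi> \<in> A" if "z \<in> S \<inter> K" "P z \<xi>" for z \<xi>
    proof -
      have "dist \<xi>0 \<xi> \<le> r"
        unfolding r_def using that \<xi>0 y(1) dist_K \<rho> \<rho>_le by (intro \<epsilon>(4)[of y \<rho> z]) auto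
      then have "\<xi>0 \<bullet> i - r \<le> \<xi> \<bullet> i \<and> \<xi> \<bullet> i \<le> \<xi>0 \<bullet> i + r" if "i \<in> Basis" for i
        using Basis_le_norm[OF that, of "\<xi> - \<xi>0"]
        by (auto simp: dist_norm norm_minus_commute inner_diff_left abs_le_iff)
      then show ?thesis
        by (auto simp: A_def mem_box inner_simps)
    qed
    moreover have "emeasure lborel A \<le> ennreal ((4 * c) ^ n) * (\<integral>\<^sup>+x\<in>interior K. h x \<partial>lborel)"
    proof -
      have "emeasure lborel A = ennreal (\<Prod>i\<in>(Basis::'a set). 2 * r)"
        unfolding A_def using r by (subst emeasure_lborel_cbox) (auto simp: inner_simps)
      also have "\<dots> = ennreal ((2 * c * g y) ^ n * s ^ n)"
        by (simp add: r_def \<rho>_def n_def power_mult_distrib mult_ac)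
      also have "\<dots> = ennreal ((2 * c * g y) ^ n) * emeasure lborel (interior K)"
      proof -
        have "emeasure lborel (interior K) = ennreal (\<Prod>i\<in>Basis. (v - u) \<bullet> i)"
          unfolding Kuv interior_cbox using vi s by (intro emeasure_lborel_box) auto
        also have "\<dots> = ennreal (s ^ n)" by (simp add: vu n_def)
        finally show ?thesis using c gy by (simp add: ennreal_mult')
      qed
      also have "\<dots> = (\<integral>\<^sup>+x\<in>interior K. ennreal ((2 * c * g y) ^ n) \<partial>lborel)"
        by (simp add: nn_integral_cmult_indicator)
      also have "\<dots> \<le> (\<integral>\<^sup>+x. ennreal ((4 * c) ^ n) * (h x * indicator (interior K) x) \<partial>lborel)"
      proof (rule nn_integral_mono)
        fix x
        show "ennreal ((2 * c * g y) ^ n) * indicator (interior K) x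
            \<le> ennreal ((4 * c) ^ n) * (h x * indicator (interior K) x)"
        proof (cases "x \<in> interior K")
          case True
          then have x: "x \<in> ball y (\<epsilon> y)" using y(3) interior_subset by blast
          then have "x \<in> V" using \<epsilon>(2) y(1) by blast
          have "(2 * c * g y) ^ n \<le> (4 * c * g x) ^ n"
            using \<epsilon>(3)[OF y(1) x] c gy by (intro power_mono) (auto simp: mult_left_mono)
          then show ?thesis
            using True \<open>x \<in> V\<close> c by (simp add: h_def ennreal_mult' [symmetric] power_mult_distrib mult.assoc ennreal_leI)
        qed simp
      qed
      also have "\<dots> = ennreal ((4 * c) ^ n) * (\<integral>\<^sup>+x\<in>interior K. h x \<partial>lborel)"
        using h_meas by (intro nn_integral_cmult) auto
      finally show ?thesis .
    qed
    moreover have "A \<in> sets lborel" by (simp add: A_def)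
    ultimately show ?thesis by blast
  qed
  then obtain A where A: "\<And>K. K \<in> \<D> \<Longrightarrow> A K \<in> sets lborel"
    "\<And>K \<xi> z. \<lbrakk>K \<in> \<D>; z \<in> S \<inter> K; P z \<xi>\<rbrakk> \<Longrightarrow> \<xi> \<in> A K"
    "\<And>K. K \<in> \<D> \<Longrightarrow> emeasure lborel (A K) \<le> ennreal ((4 * c) ^ n) * (\<integral>\<^sup>+x\<in>interior K. h x \<partial>lborel)"
    by metis
  \<comment> \<open>The family may be finite, so indices outside \<open>I\<close> receive the empty
    set in \<open>A'\<close> and \<open>J\<close>. The sets \<open>J k\<close> are interiors because
    the cubes themselves may share faces.\<close>
  define I where "I = to_nat_on \<D> ` \<D>"
  define E where "E k = from_nat_into \<D> k" for k
  have E: "E k \<in> \<D>" if "k \<in> I" for k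
    using that cnt by (auto simp: E_def I_def)
  have E_inj: "E j \<noteq> E k" if "j \<in> I" "k \<in> I" "j \<noteq> k" for j k
    using that cnt by (auto simp: E_def I_def)
  have E_surj: "\<exists>k\<in>I. E k = K" if "K \<in> \<D>" for K
    using that cnt by (auto simp: E_def I_def)
  define A' where "A' k = (if k \<in> I then A (E k) else {})" for k
  define J where "J k = (if k \<in> I then interior (E k) else {})" for k
  have "T \<subseteq> (\<Union>k. A' k)"
  proof
    fix \<xi> assume "\<xi> \<in> T"
    then obtain y where y: "y \<in> S" "P y \<xi>" using T by blast
    then obtain K where K: "K \<in> \<D>" "y \<in> K" using cov by blast
    then obtain k where "k \<in> I" "E k = K" using E_surj by blast
    then show "\<xi> \<in> (\<Union>k. A' k)" using A(2)[OF K(1)] y K by (auto simp: A'_def intro!: exI[of _ k])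
  qed
  moreover have A'_sets: "A' k \<in> sets lborel" for k
    using A(1) E by (simp add: A'_def)
  ultimately have "emeasure lborel T \<le> emeasure lborel (\<Union>k. A' k)"
    by (intro emeasure_mono) auto
  also have "\<dots> \<le> (\<Sum>k. emeasure lborel (A' k))"
    using A'_sets by (intro emeasure_subadditive_countably) auto
  also have "\<dots> \<le> (\<Sum>k. ennreal ((4 * c) ^ n) * (\<integral>\<^sup>+x\<in>J k. h x \<partial>lborel))"
    using A(3) E by (intro suminf_le) (auto simp: A'_def J_def)
  also have "\<dots> = ennreal ((4 * c) ^ n) * (\<Sum>k. \<integral>\<^sup>+x\<in>J k. h x \<partial>lborel)"
    by (rule ennreal_suminf_cmult)
  also have "(\<Sum>k. \<integral>\<^sup>+x\<in>J k. h x \<partial>lborel) = (\<integral>\<^sup>+x\<in>(\<Union>k. J k). h x \<partial>lborel)"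
  proof (rule nn_integral_disjoint_family[symmetric])
    show "disjoint_family J"
      using disj E E_inj unfolding disjoint_family_on_def pairwise_def J_def by auto
  qed (use h_meas in \<open>auto simp: J_def\<close>)
  also have "\<dots> \<le> (\<integral>\<^sup>+x\<in>V. ennreal (g x ^ n) \<partial>lborel)"
    by (intro nn_integral_mono) (auto simp: h_def indicator_def)
  finally show ?thesis
    by (simp add: n_def c_def mult_left_mono)
qed

text \<open>Outer regularity brings the integral from open neighbourhoods down to \<open>S\<close>:
  an open \<open>V\<close> around \<open>S\<close> is taken inside a compact subset of
  \<open>U\<close>, where \<open>g\<close> is bounded by \<open>B\<close>, with \<open>V - S\<close>
  so small that it contributes at most \<open>\<epsilon>\<close>.\<close>

lemma emeasure_le_nn_integral_compact:
  fixes S U :: "'a::euclidean_space set" and P :: "'a \<Rightarrow> 'a \<Rightarrow> bool"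
  assumes "compact S" "S \<subseteq> U" "open U"
    and g: "continuous_on U g" "\<And>x. x \<in> U \<Longrightarrow> 0 < g x"
    and T: "\<And>\<xi>. \<xi> \<in> T \<Longrightarrow> \<exists>y\<in>S. P y \<xi>"
    and ex: "\<And>y. y \<in> S \<Longrightarrow> \<exists>\<xi>. P y \<xi>"
    and loc: "\<And>y. y \<in> S \<Longrightarrow> \<exists>\<delta>>0. \<forall>\<rho> z \<xi> \<zeta>. 0 < \<rho> \<longrightarrow> \<rho> < \<delta> \<longrightarrow> z \<in> S \<longrightarrow>
      dist y z \<le> \<rho> \<longrightarrow> P y \<xi> \<longrightarrow> P z \<zeta> \<longrightarrow> dist \<xi> \<zeta> \<le> \<rho> * g y"
  shows "emeasure lborel T \<le>
    ennreal ((4 * sqrt DIM('a)) ^ DIM('a)) * (\<integral>\<^sup>+x\<in>S. ennreal (g x ^ DIM('a)) \<partial>lborel)"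
proof (rule ennreal_le_epsilon)
  define n where "n = DIM('a)"
  define c where "c = (4 * sqrt n) ^ n"
  have c: "c \<ge> 0" by (simp add: c_def)
  fix \<epsilon> :: real assume "0 < \<epsilon>"
  obtain e where e: "e > 0" "(\<Union>x\<in>S. cball x e) \<subseteq> U"
    using compact_subset_open_imp_cball_epsilon_subset[OF \<open>compact S\<close> \<open>open U\<close> \<open>S \<subseteq> U\<close>] by blast
  \<comment> \<open>The closed neighbourhood \<open>N\<close> is a Minkowski sum of compact sets and
    hence compact; \<open>N0\<close> is its open counterpart.\<close>
  define N where "N = {x + y | x y. x \<in> S \<and> y \<in> cball 0 e}"
  define N0 where "N0 = (\<Union>x\<in>S. ball x e)"
  have "compact N" unfolding N_def by (intro compact_sums \<open>compact S\<close> compact_cball)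
  have "N \<subseteq> U" using e(2) by (force simp: N_def dist_norm)
  have "N0 \<subseteq> N"
  proof
    fix w assume "w \<in> N0"
    then obtain x where "x \<in> S" "dist x w < e" by (auto simp: N0_def)
    then show "w \<in> N" unfolding N_def
      by (intro CollectI exI[of _ x] exI[of _ "w - x"]) (auto simp: dist_norm norm_minus_commute)
  qed
  have "S \<subseteq> N0" using e(1) by (auto simp: N0_def)
  have "open N0" by (auto simp: N0_def)
  have "compact (g ` N)"
    using \<open>compact N\<close> g(1) \<open>N \<subseteq> U\<close> by (meson compact_continuous_image continuous_on_subset)
  then obtain B where B: "B > 0" "\<And>x. x \<in> N \<Longrightarrow> g x \<le> B"
    using compact_imp_bounded[of "g ` N"] unfolding bounded_pos by force
  \<comment> \<open>Chosen so that \<open>c * B ^ n * \<epsilon>' \<le> \<epsilon>\<close>; the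
    \<open>+ 1\<close> keeps the denominator positive.\<close>
  define \<epsilon>' where "\<epsilon>' = \<epsilon> / (c * B ^ n + 1)"
  have den: "c * B ^ n + 1 > 0" using B(1) c by (simp add: add_nonneg_pos)
  then have \<epsilon>': "\<epsilon>' > 0" using \<open>0 < \<epsilon>\<close> by (simp add: \<epsilon>'_def)
  have "S \<in> sets lebesgue" using \<open>compact S\<close> by (simp add: lmeasurable_compact fmeasurableD)
  then obtain V0 where V0: "open V0" "S \<subseteq> V0" "V0 - S \<in> lmeasurable"
      "emeasure lebesgue (V0 - S) < ennreal \<epsilon>'"
    using sets_lebesgue_outer_open[OF _ \<epsilon>'] by blast
  define V where "V = V0 \<inter> N0"
  have V: "open V" "S \<subseteq> V" "V \<subseteq> N" "V \<subseteq> U"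
    using V0 \<open>open N0\<close> \<open>S \<subseteq> N0\<close> \<open>N0 \<subseteq> N\<close> \<open>N \<subseteq> U\<close> by (auto simp: V_def)
  have Sb: "S \<in> sets borel" using \<open>compact S\<close> by (simp add: borel_compact)
  have small: "emeasure lborel (V - S) \<le> ennreal \<epsilon>'"
  proof -
    have "emeasure lborel (V - S) \<le> emeasure lborel (V0 - S)"
      using V0(1) Sb by (intro emeasure_mono) (auto simp: V_def)
    also have "\<dots> = emeasure lebesgue (V0 - S)"
      using V0(1) Sb by simp
    finally show ?thesis using V0(4) by simp
  qed
  have "emeasure lborel T \<le> ennreal c * (\<integral>\<^sup>+x\<in>V. ennreal (g x ^ n) \<partial>lborel)"
    unfolding c_def n_def
  proof (rule emeasure_le_nn_integral_open[OF _ V(2,1) _ _ T ex loc])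
    show "bounded S" using \<open>compact S\<close> by (rule compact_imp_bounded)
    show "continuous_on V g" using g(1) V(4) by (rule continuous_on_subset)
  qed (use g(2) V(4) in auto)
  also have "(\<integral>\<^sup>+x\<in>V. ennreal (g x ^ n) \<partial>lborel)
      \<le> (\<integral>\<^sup>+x. ennreal (g x ^ n) * indicator S x + ennreal (B ^ n) * indicator (V - S) x \<partial>lborel)"
  proof (rule nn_integral_mono)
    fix x
    show "ennreal (g x ^ n) * indicator V x
      \<le> ennreal (g x ^ n) * indicator S x + ennreal (B ^ n) * indicator (V - S) x"
    proof (cases "x \<in> V - S")
      case True
      then have "g x ^ n \<le> B ^ n"
        using B(2)[of x] g(2)[of x] V by (intro power_mono) (auto intro: less_imp_le)
      with True show ?thesis by (simp add: ennreal_leI)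
    qed (use V(2) in \<open>auto simp: indicator_def\<close>)
  qed
  also have "\<dots> = (\<integral>\<^sup>+x\<in>S. ennreal (g x ^ n) \<partial>lborel) + ennreal (B ^ n) * emeasure lborel (V - S)"
  proof (subst nn_integral_add)
    show "(\<lambda>x. ennreal (g x ^ n) * indicator S x) \<in> borel_measurable lborel"
      using Sb g(1) \<open>S \<subseteq> U\<close>
      by (intro borel_measurable_ennreal_indicator continuous_intros) (auto intro: continuous_on_subset)
    have [measurable]: "V - S \<in> sets borel" using V(1) Sb by auto
    show "(\<lambda>x. ennreal (B ^ n) * indicator (V - S) x) \<in> borel_measurable lborel" by measurable
  qed (use V Sb in \<open>auto simp: nn_integral_cmult_indicator\<close>)
  also have "ennreal c * ((\<integral>\<^sup>+x\<in>S. ennreal (g x ^ n) \<partial>lborel) + ennreal (B ^ n) * emeasure lborel (V - S))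
      \<le> ennreal c * (\<integral>\<^sup>+x\<in>S. ennreal (g x ^ n) \<partial>lborel) + ennreal \<epsilon>"
  proof -
    have "ennreal c * (ennreal (B ^ n) * emeasure lborel (V - S)) \<le> ennreal c * (ennreal (B ^ n) * ennreal \<epsilon>')"
      by (intro mult_left_mono small) auto
    also have "\<dots> = ennreal (c * B ^ n * \<epsilon>')"
      using c B(1) \<epsilon>' by (simp add: ennreal_mult' mult.assoc)
    also have "\<dots> \<le> ennreal \<epsilon>"
    proof (rule ennreal_leI)
      have "c * B ^ n * \<epsilon>' \<le> (c * B ^ n + 1) * \<epsilon>'" using \<epsilon>' by simp
      also have "\<dots> = \<epsilon>" using den by (simp add: \<epsilon>'_def)
      finally show "c * B ^ n * \<epsilon>' \<le> \<epsilon>" .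
    qed
    finally show ?thesis by (simp add: distrib_left add_left_mono)
  qed
  finally show "emeasure lborel T \<le>
      ennreal ((4 * sqrt DIM('a)) ^ DIM('a)) * (\<integral>\<^sup>+x\<in>S. ennreal (g x ^ DIM('a)) \<partial>lborel) + ennreal \<epsilon>"
    by (simp add: c_def n_def mult_left_mono)
qed

section \<open>The barrier\<close>

lemma C2_on_quadratic:
  fixes H :: "real ^ 'n ^ 'n"
  assumes "transpose H = H"
  shows "C2_on U (\<lambda>x. c + v \<bullet> (x - y) + (x - y) \<bullet> (H *v (x - y)) / 2) (\<lambda>x. v + H *v (x - y)) (\<lambda>_. H)"
  unfolding C2_on_def
proof (intro conjI ballI continuous_on_const)
  fix x
  have sym: "a \<bullet> (H *v b) = b \<bullet> (H *v a)" for a b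
    by (metis assms dot_lmul_matrix inner_commute vector_transpose_matrix)
  have H: "((\<lambda>x. H *v (x - y)) has_derivative (\<lambda>h. H *v h)) (at x)"
    by (rule has_derivative_eq_rhs[OF bounded_linear.has_derivative[OF matrix_vector_mul_bounded_linear]])
       (auto intro!: derivative_eq_intros)
  show "((\<lambda>x. v + H *v (x - y)) has_derivative (\<lambda>h. H *v h)) (at x)"
    by (rule has_derivative_eq_rhs[OF has_derivative_add[OF has_derivative_const H]]) simp
  show "GDERIV (\<lambda>x. c + v \<bullet> (x - y) + (x - y) \<bullet> (H *v (x - y)) / 2) x :> v + H *v (x - y)"
  proof -
    have "((\<lambda>x. c + v \<bullet> (x - y) + (x - y) \<bullet> (H *v (x - y)) / 2)
        has_derivative (\<lambda>h. v \<bullet> h + ((x - y) \<bullet> (H *v h) + h \<bullet> (H *v (x - y))) / 2)) (at x)"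
      by (auto intro!: derivative_eq_intros H)
    also have "(\<lambda>h. v \<bullet> h + ((x - y) \<bullet> (H *v h) + h \<bullet> (H *v (x - y))) / 2)
        = (\<lambda>h. h \<bullet> (v + H *v (x - y)))"
    proof
      fix h
      show "v \<bullet> h + ((x - y) \<bullet> (H *v h) + h \<bullet> (H *v (x - y))) / 2 = h \<bullet> (v + H *v (x - y))"
        by (simp add: inner_add_right sym[of "x - y" h] inner_commute[of v h])
    qed
    finally show ?thesis by (simp add: gderiv_def)
  qed
qed

text \<open>The Hessian of the barrier, for small \<open>b\<close>: concave along \<open>e\<close>, slightly convex across it.\<close>

definition barrier_hessian :: "real \<Rightarrow> real ^ 'n \<Rightarrow> real ^ 'n ^ 'n" where
  "barrier_hessian b e = mat b - (\<chi> i j. e $ i * e $ j / 2)"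

lemma transpose_barrier_hessian: "transpose (barrier_hessian b e) = barrier_hessian b e"
  by (auto simp: barrier_hessian_def transpose_def vec_eq_iff mat_def mult.commute)

lemma barrier_hessian_mult:
  "barrier_hessian b e *v x = b *\<^sub>R x - ((e \<bullet> x) / 2) *\<^sub>R e"
  for e :: "real ^ 'n"
proof -
  have "(\<chi> i j. e $ i * e $ j / 2) *v x = ((e \<bullet> x) / 2) *\<^sub>R e"
    by (simp add: vec_eq_iff matrix_vector_mult_def inner_vec_def sum_divide_distrib sum_distrib_left
        sum_distrib_right mult_ac)
  then show ?thesis by (simp add: barrier_hessian_def matrix_vector_mult_diff_rdistrib mat_mult_vec)
qed

lemma scaleR_matrix_vector_mult: "(s *\<^sub>R A) *v x = s *\<^sub>R (A *v x)" for A :: "real ^ 'n ^ 'm"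
  by (simp add: vec_eq_iff matrix_vector_mult_def sum_distrib_left mult.assoc)

lemma diag_mult_vec: "diag a *v x = (\<chi> i. a $ i * x $ i)" for a x :: "real ^ 'n"
  by (simp add: vec_eq_iff diag_def matrix_vector_mult_def if_distrib[where f = "\<lambda>x. x * _"] cong: if_cong)

lemma transpose_diag: "transpose (diag a) = diag a"
  by (auto simp: diag_def transpose_def vec_eq_iff)

text \<open>The plane supporting \<open>u\<close> at \<open>z\<close> pushes \<open>u\<close> below the plane supporting it at \<open>y\<close> by at least
  \<open>\<eta> * \<rho>\<close> at distance \<open>\<rho>\<close> from \<open>y\<close> in the direction \<open>e = - (\<zeta> - \<xi>) / \<bar>\<zeta> - \<xi>\<bar>\<close>.  The test function adds to
  the plane at \<open>y\<close> the term \<open>\<eta> * \<rho> * (- t / 2 - t\<^sup>2 / 4 + \<bar>x - y\<bar>\<^sup>2 / (k * \<rho>)\<^sup>2)\<close> with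
  \<open>t = e \<bullet> (x - y) / \<rho>\<close>, which exceeds \<open>u\<close> on the boundary of the slab
  \<open>\<bar>t\<bar> \<le> 1, \<bar>x - y\<bar> \<le> k * \<rho>\<close> but not at \<open>y\<close>, so that \<open>u - \<psi>\<close> has an interior maximum there.\<close>

lemma visc_plus_ge_barrier:
  fixes \<Omega> :: "(real ^ 'n) set"
  assumes visc: "visc_plus_ge p l L \<Omega> f u" and u: "continuous_on \<Omega> u"
    and yz: "y \<in> \<Omega>" "z \<in> \<Omega>"
    and contact_y: "\<And>x. x \<in> \<Omega> \<Longrightarrow> u x \<le> u y + \<xi> \<bullet> (x - y)"
    and contact_z: "\<And>x. x \<in> \<Omega> \<Longrightarrow> u x \<le> u z + \<zeta> \<bullet> (x - z)"
    and \<rho>: "0 < \<rho>" "norm (z - y) \<le> \<rho> / 2"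
    and k: "2 \<le> k" "cball y (k * \<rho>) \<subseteq> \<Omega>"
    and \<eta>: "0 < \<eta>" "\<eta> \<le> norm (\<zeta> - \<xi>) / 2"
  obtains x q e where "x \<in> \<Omega>" "dist y x < k * \<rho>" "norm (q - \<xi>) \<le> 2 * \<eta>" "norm e = 1"
    "f x \<le> pucci_plus l L (weighted_hessian p q ((\<eta> / \<rho>) *\<^sub>R barrier_hessian (2 / k\<^sup>2) e))
      + L * norm q powr (p + 1)"
proof -
  define N where "N = norm (\<zeta> - \<xi>)"
  have N: "N > 0" "2 * \<eta> \<le> N" using \<eta> unfolding N_def by linarith+
  define e where "e = - ((\<zeta> - \<xi>) /\<^sub>R N)"
  have e: "norm e = 1" "\<zeta> - \<xi> = - (N *\<^sub>R e)"
    using N(1) by (simp_all add: e_def N_def)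
  define H where "H = (\<eta> / \<rho>) *\<^sub>R barrier_hessian (2 / k\<^sup>2) e"
  have H_sym: "transpose H = H"
    unfolding H_def by (simp add: transpose_barrier_hessian transpose_scalar)
  have Hx: "H *v x = (\<eta> / \<rho>) *\<^sub>R ((2 / k\<^sup>2) *\<^sub>R x - ((e \<bullet> x) / 2) *\<^sub>R e)" for x
    by (simp add: H_def scaleR_matrix_vector_mult barrier_hessian_mult)
  define v where "v = \<xi> - (\<eta> / 2) *\<^sub>R e"
  define \<psi> where "\<psi> x = u y + v \<bullet> (x - y) + (x - y) \<bullet> (H *v (x - y)) / 2" for x
  have \<psi>: "\<psi> x = u y + \<xi> \<bullet> (x - y)
      + \<eta> * \<rho> * (- (e \<bullet> (x - y) / \<rho>) / 2 - (e \<bullet> (x - y) / \<rho>)\<^sup>2 / 4 + (norm (x - y) / (k * \<rho>))\<^sup>2)" for x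
  proof -
    have quad: "a \<bullet> (H *v a) = (\<eta> / \<rho>) * (2 / k\<^sup>2 * (norm a)\<^sup>2 - (e \<bullet> a)\<^sup>2 / 2)" for a
      by (simp add: Hx inner_diff_right dot_square_norm inner_commute[of a e] power2_eq_square)
    have v: "v \<bullet> a = \<xi> \<bullet> a - \<eta> / 2 * (e \<bullet> a)" for a
      by (simp add: v_def inner_diff_left)
    have "q - \<eta> / 2 * t + (\<eta> / \<rho>) * (2 / k\<^sup>2 * m\<^sup>2 - t\<^sup>2 / 2) / 2
        = q + \<eta> * \<rho> * (- (t / \<rho>) / 2 - (t / \<rho>)\<^sup>2 / 4 + (m / (k * \<rho>))\<^sup>2)" for q t m :: real
      using \<rho>(1) k(1) by (simp add: field_simps power2_eq_square)
    then show ?thesis unfolding \<psi>_def quad v by (simp add: add.assoc)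
  qed
  define D where "D = cball y (k * \<rho>) \<inter> {x. \<bar>e \<bullet> (x - y)\<bar> \<le> \<rho>}"
  have "compact D" unfolding D_def
    by (intro compact_Int_closed compact_cball closed_Collect_le continuous_intros)
  moreover have "y \<in> D" using \<rho>(1) k(1) by (simp add: D_def)
  moreover have "continuous_on D (\<lambda>x. u x - \<psi> x)"
    unfolding \<psi>_def Hx using k by (intro continuous_intros continuous_on_subset[OF u]) (auto simp: D_def)
  ultimately obtain x where x: "x \<in> D" and max: "\<And>w. w \<in> D \<Longrightarrow> u w - \<psi> w \<le> u x - \<psi> x"
    using continuous_attains_sup[of D "\<lambda>x. u x - \<psi> x"] by blast
  \<comment> \<open>\<open>\<psi>\<close> agrees with \<open>u\<close> at \<open>y\<close>, so the
    maximum of \<open>u - \<psi>\<close> over \<open>D\<close> is nonnegative. Each piece of the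
    boundary of \<open>D\<close> is then excluded because \<open>u < \<psi>\<close> there.\<close>
  have nonneg: "\<psi> x \<le> u x" using max[OF \<open>y \<in> D\<close>] \<rho>(1) by (simp add: \<psi>)
  have x\<Omega>: "x \<in> \<Omega>" using x k(2) by (auto simp: D_def)
  define s where "s = e \<bullet> (x - y) / \<rho>"
  have s: "\<bar>s\<bar> \<le> 1" using x \<rho>(1) by (simp add: s_def D_def)
  have ed: "\<eta> * \<rho> > 0" using \<eta> \<rho> by simp
  have below: "u x \<le> u y + \<xi> \<bullet> (x - y)" by (rule contact_y[OF x\<Omega>])
  \<comment> \<open>On the sphere the convex term equals 1, while
    \<open>- s / 2 - s\<^sup>2 / 4\<close> is at least \<open>- 3 / 4\<close> for
    \<open>\<bar>s\<bar> \<le> 1\<close>.\<close>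
  have "dist y x \<noteq> k * \<rho>"
  proof
    assume "dist y x = k * \<rho>"
    then have "norm (x - y) = k * \<rho>"
      by (metis dist_commute dist_norm)
    then have one: "norm (x - y) / (k * \<rho>) = 1"
      using \<rho>(1) k(1) by simp
    have \<psi>x: "\<psi> x = u y + \<xi> \<bullet> (x - y) + \<eta> * \<rho> * (- s / 2 - s\<^sup>2 / 4 + 1)"
      unfolding \<psi> one s_def by simp
    have "s\<^sup>2 \<le> 1" using s by (simp add: abs_square_le_1)
    with s have "- s / 2 - s\<^sup>2 / 4 + 1 > 0" by linarith
    with ed have "0 < \<eta> * \<rho> * (- s / 2 - s\<^sup>2 / 4 + 1)" by simp
    with \<psi>x below nonneg show False by linarith
  qed
  with x have dx: "dist y x < k * \<rho>" by (auto simp: D_def)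
  have sq: "0 \<le> (norm (x - y) / (k * \<rho>))\<^sup>2" by simp
  have "s \<noteq> - 1"
  proof
    assume "s = - 1"
    then have \<psi>x: "\<psi> x = u y + \<xi> \<bullet> (x - y) + \<eta> * \<rho> * (1 / 4 + (norm (x - y) / (k * \<rho>))\<^sup>2)"
      unfolding \<psi> s_def[symmetric] by simp
    have "0 < \<eta> * \<rho> * (1 / 4 + (norm (x - y) / (k * \<rho>))\<^sup>2)"
      using ed by (rule mult_pos_pos) (use sq in linarith)
    with \<psi>x below nonneg show False by linarith
  qed
  \<comment> \<open>Here the plane at \<open>z\<close> enters: \<open>x\<close> is at least
    \<open>\<rho> / 2\<close> further along \<open>e\<close> than \<open>z\<close>, so at
    \<open>x\<close> that plane is at least \<open>N * (\<rho> / 2) \<ge> \<eta> * \<rho>\<close>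
    below the one at \<open>y\<close>, whereas \<open>\<psi>\<close> drops below the latter by at
    most \<open>3 / 4\<close> of \<open>\<eta> * \<rho>\<close>.\<close>
  moreover have "s \<noteq> 1"
  proof
    assume s1: "s = 1"
    then have ex: "e \<bullet> (x - y) = \<rho>" using \<rho>(1) by (simp add: s_def)
    have \<psi>x: "\<psi> x = u y + \<xi> \<bullet> (x - y) + \<eta> * \<rho> * (- 3 / 4 + (norm (x - y) / (k * \<rho>))\<^sup>2)"
      unfolding \<psi> s_def[symmetric] by (simp add: s1)
    have "\<bar>e \<bullet> (z - y)\<bar> \<le> \<rho> / 2"
      using Cauchy_Schwarz_ineq2[of e "z - y"] e(1) \<rho>(2) by simp
    then have "e \<bullet> (x - z) \<ge> \<rho> / 2"
      using ex unfolding inner_diff_right by linarith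
    then have "N * (\<rho> / 2) \<le> N * (e \<bullet> (x - z))" using N(1) by (intro mult_left_mono) auto
    moreover have "\<eta> * \<rho> \<le> N * (\<rho> / 2)"
      using mult_right_mono[OF N(2), of "\<rho> / 2"] \<rho>(1) by simp
    moreover have "(\<zeta> - \<xi>) \<bullet> (x - z) = - N * (e \<bullet> (x - z))" by (simp add: e(2))
    moreover have "u x \<le> u y + \<xi> \<bullet> (x - y) + (\<zeta> - \<xi>) \<bullet> (x - z)"
      using contact_z[OF x\<Omega>] contact_y[OF yz(2)] by (simp add: inner_diff_left inner_diff_right)
    moreover have "\<eta> * \<rho> * (- 3 / 4) \<le> \<eta> * \<rho> * (- 3 / 4 + (norm (x - y) / (k * \<rho>))\<^sup>2)"
      using ed sq by (intro mult_left_mono) linarith+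
    ultimately show False using \<psi>x nonneg ed by linarith
  qed
  ultimately have "\<bar>s\<bar> < 1" using s by linarith
  then have ex: "\<bar>e \<bullet> (x - y)\<bar> < \<rho>" using \<rho>(1) by (simp add: s_def)
  have "local_max_at (\<lambda>x. u x - \<psi> x) x"
  proof -
    let ?W = "ball y (k * \<rho>) \<inter> {x. \<bar>e \<bullet> (x - y)\<bar> < \<rho>}"
    have "open ?W" by (intro open_Int open_ball open_Collect_less continuous_intros)
    moreover have "x \<in> ?W" using dx ex by simp
    ultimately have "eventually (\<lambda>w. w \<in> ?W) (nhds x)" by (rule eventually_nhds_in_open)
    then show ?thesis unfolding local_max_at_def
      by eventually_elim (rule max, auto simp: D_def)
  qed
  moreover have "C2_on \<Omega> \<psi> (\<lambda>x. v + H *v (x - y)) (\<lambda>_. H)"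
    unfolding \<psi>_def by (rule C2_on_quadratic[OF H_sym])
  ultimately have f: "f x \<le> pucci_plus l L (weighted_hessian p (v + H *v (x - y)) H)
      + L * norm (v + H *v (x - y)) powr (p + 1)"
    using visc x\<Omega> unfolding visc_plus_ge_def by blast
  \<comment> \<open>The isotropic part of the gradient contributes at most
    \<open>\<eta> * (2 / k) \<le> \<eta>\<close>, and the part along \<open>e\<close> at most
    \<open>\<eta>\<close> because \<open>\<bar>s\<bar> \<le> 1\<close>.\<close>
  have "norm (v + H *v (x - y) - \<xi>) \<le> 2 * \<eta>"
  proof -
    have "norm (v + H *v (x - y) - \<xi>)
        = norm ((\<eta> / \<rho> * (2 / k\<^sup>2)) *\<^sub>R (x - y) - (\<eta> / 2 + \<eta> / \<rho> * (e \<bullet> (x - y)) / 2) *\<^sub>R e)"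
      by (rule arg_cong[where f = norm])
         (simp add: v_def Hx scaleR_diff_right scaleR_add_left del: scaleR_diff_left)
    also have "\<dots> \<le> \<eta> / \<rho> * (2 / k\<^sup>2) * norm (x - y) + \<bar>\<eta> / 2 + \<eta> / \<rho> * (e \<bullet> (x - y)) / 2\<bar>"
      by (rule order_trans[OF norm_triangle_ineq4]) (use \<eta>(1) \<rho>(1) e(1) in simp)
    also have "\<dots> \<le> \<eta> / \<rho> * (2 / k\<^sup>2) * (k * \<rho>) + \<eta>"
    proof (rule add_mono)
      show "\<eta> / \<rho> * (2 / k\<^sup>2) * norm (x - y) \<le> \<eta> / \<rho> * (2 / k\<^sup>2) * (k * \<rho>)"
        using dx \<eta>(1) \<rho>(1) by (intro mult_left_mono) (auto simp: dist_commute simp flip: dist_norm)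
      have "\<eta> / \<rho> * (e \<bullet> (x - y)) / 2 = \<eta> * s / 2" by (simp add: s_def)
      moreover have "\<bar>\<eta> * s\<bar> \<le> \<eta>"
        using s \<eta>(1) by (simp add: abs_mult mult_left_le)
      ultimately show "\<bar>\<eta> / 2 + \<eta> / \<rho> * (e \<bullet> (x - y)) / 2\<bar> \<le> \<eta>"
        using \<eta>(1) by linarith
    qed
    also have "\<eta> / \<rho> * (2 / k\<^sup>2) * (k * \<rho>) = \<eta> * (2 / k)"
      using \<rho>(1) k(1) by (simp add: field_simps power2_eq_square)
    also have "\<dots> \<le> \<eta> * 1" using k(1) \<eta>(1) by (intro mult_left_mono) auto
    finally show ?thesis by simp
  qed
  from that[OF x\<Omega> dx this e(1)] f show thesis by (simp add: H_def)
qed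

lemma half_pow_square: "0 < s \<Longrightarrow> (half_pow p s)\<^sup>2 = s powr p"
  by (simp add: half_pow_def power2_eq_square flip: powr_add)

lemma half_pow_nonneg: "0 \<le> half_pow p s"
  by (simp add: half_pow_def)

lemma norm_vec_square: "(norm x)\<^sup>2 = (\<Sum>i\<in>UNIV. (x $ i)\<^sup>2)" for x :: "real ^ 'n"
  by (simp add: norm_vec_def L2_set_def sum_nonneg)

text \<open>The squared weights lie between \<open>r = (R / 2) powr p\<close> and
  \<open>6 powr p * r\<close>, where 6 is the quotient of \<open>3 * R\<close> and
  \<open>R / 2\<close>. Testing the weighted form with \<open>e\<close> gives at most
  \<open>- s * r / 2\<close> up to an error of order \<open>b\<close>, and the positive eigenvalues
  are at most \<open>6 powr p * b * s * r\<close>. For small \<open>b\<close> the negative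
  eigenvalue wins, with the factor \<open>l / 4\<close> left over.\<close>

lemma pucci_plus_weighted_barrier_le:
  fixes q e :: "real ^ 'n" and p l L R s b :: real
  assumes "0 \<le> p" "0 < l" "l \<le> L" "0 < R"
    and q: "\<And>i. R / 2 \<le> q $ i \<and> q $ i \<le> 3 * R"
    and e: "norm e = 1" and s: "0 < s" and b: "0 \<le> b"
    and small: "(l + L * CARD('n)) * 6 powr p * b \<le> l / 4"
  shows "pucci_plus l L (weighted_hessian p q (s *\<^sub>R barrier_hessian b e))
    \<le> - (l / 4) * s * (R / 2) powr p"
proof -
  define \<alpha> where "\<alpha> = (\<chi> i. half_pow p (q $ i))"
  define W where "W = weighted_hessian p q (s *\<^sub>R barrier_hessian b e)"
  define r where "r = (R / 2) powr p"
  define T :: real where "T = 6 powr p"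
  have r: "r > 0" using \<open>0 < R\<close> by (simp add: r_def)
  have W: "W = diag \<alpha> ** (s *\<^sub>R barrier_hessian b e) ** diag \<alpha>"
    by (simp add: W_def weighted_hessian_def \<alpha>_def)
  have \<alpha>_sq: "r \<le> (\<alpha> $ i)\<^sup>2" "(\<alpha> $ i)\<^sup>2 \<le> T * r" for i
  proof -
    have "0 < q $ i" using q[of i] \<open>0 < R\<close> by linarith
    then have *: "(\<alpha> $ i)\<^sup>2 = (q $ i) powr p" by (simp add: \<alpha>_def half_pow_square)
    show "r \<le> (\<alpha> $ i)\<^sup>2" unfolding * r_def
      using q[of i] \<open>0 < R\<close> \<open>0 \<le> p\<close> by (intro powr_mono2) auto
    have "(q $ i) powr p \<le> (6 * (R / 2)) powr p"
      using q[of i] \<open>0 < R\<close> \<open>0 \<le> p\<close> by (intro powr_mono2) auto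
    also have "\<dots> = T * r" using \<open>0 < R\<close> unfolding T_def r_def by (intro powr_mult)
    finally show "(\<alpha> $ i)\<^sup>2 \<le> T * r" unfolding * .
  qed
  have W_form: "x \<bullet> (W *v x) = s * (b * (norm (diag \<alpha> *v x))\<^sup>2 - (e \<bullet> (diag \<alpha> *v x))\<^sup>2 / 2)" for x
  proof -
    have "x \<bullet> (W *v x) = (diag \<alpha> *v x) \<bullet> ((s *\<^sub>R barrier_hessian b e) *v (diag \<alpha> *v x))"
      unfolding W by (metis dot_lmul_matrix matrix_vector_mul_assoc transpose_diag vector_transpose_matrix)
    also have "\<dots> = s * (b * (norm (diag \<alpha> *v x))\<^sup>2 - (e \<bullet> (diag \<alpha> *v x))\<^sup>2 / 2)"
      by (simp add: scaleR_matrix_vector_mult barrier_hessian_mult inner_diff_right dot_square_norm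
          inner_commute[of _ e] power2_eq_square)
    finally show ?thesis .
  qed
  have norm_diag: "(norm (diag \<alpha> *v x))\<^sup>2 \<le> T * r * (norm x)\<^sup>2" for x
  proof -
    have "(norm (diag \<alpha> *v x))\<^sup>2 = (\<Sum>i\<in>UNIV. (\<alpha> $ i)\<^sup>2 * (x $ i)\<^sup>2)"
      by (simp add: norm_vec_square diag_mult_vec power_mult_distrib)
    also have "\<dots> \<le> (\<Sum>i\<in>UNIV. T * r * (x $ i)\<^sup>2)"
      by (intro sum_mono mult_right_mono \<alpha>_sq) auto
    also have "\<dots> = T * r * (norm x)\<^sup>2"
      by (simp add: norm_vec_square sum_distrib_left)
    finally show ?thesis .
  qed
  have "r \<le> (e \<bullet> (diag \<alpha> *v e))\<^sup>2"
  proof -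
    have "sqrt r = sqrt r * (\<Sum>i\<in>UNIV. (e $ i)\<^sup>2)"
      using e norm_vec_square[of e] by simp
    also have "\<dots> \<le> (\<Sum>i\<in>UNIV. \<alpha> $ i * (e $ i)\<^sup>2)"
      unfolding sum_distrib_left
      by (intro sum_mono mult_right_mono real_le_lsqrt \<alpha>_sq) (auto simp: \<alpha>_def half_pow_nonneg)
    also have "\<dots> = e \<bullet> (diag \<alpha> *v e)"
      by (simp add: inner_vec_def diag_mult_vec power2_eq_square mult_ac)
    finally have "(sqrt r)\<^sup>2 \<le> (e \<bullet> (diag \<alpha> *v e))\<^sup>2"
      using r by (intro power_mono) auto
    then show ?thesis using r by simp
  qed
  moreover have "b * (norm (diag \<alpha> *v e))\<^sup>2 \<le> b * (T * r)"
    using norm_diag[of e] e b by (intro mult_left_mono) auto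
  ultimately have "e \<bullet> (W *v e) \<le> s * (b * (T * r) - r / 2)"
    unfolding W_form using s by (intro mult_left_mono) auto
  then have low: "e \<bullet> (W *v e) \<le> - (s * r * (1 / 2 - T * b))"
    by (simp add: algebra_simps)
  have up: "x \<bullet> (W *v x) \<le> (s * r * (T * b)) * (norm x)\<^sup>2" for x
  proof -
    have "x \<bullet> (W *v x) \<le> s * (b * (norm (diag \<alpha> *v x))\<^sup>2)"
      unfolding W_form using s by (intro mult_left_mono) auto
    also have "\<dots> \<le> s * (b * (T * r * (norm x)\<^sup>2))"
      using s b by (intro mult_left_mono norm_diag) auto
    finally show ?thesis by (simp add: mult_ac)
  qed
  have T0: "T * b \<ge> 0" using b by (simp add: T_def)
  have L: "L \<ge> 0" using \<open>0 < l\<close> \<open>l \<le> L\<close> by simp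
  have small': "(l + L * CARD('n)) * (T * b) \<le> l / 4"
    using small by (simp add: T_def mult.assoc)
  have "l * (T * b) \<le> (l + L * CARD('n)) * (T * b)"
    using T0 L by (intro mult_right_mono) auto
  with small' have "l * (T * b) \<le> l * (1 / 4)" by linarith
  then have "T * b \<le> 1 / 4" using \<open>0 < l\<close> by (rule mult_left_le_imp_le)
  then have a: "0 < s * r * (1 / 2 - T * b)" using s r by simp
  have sym: "transpose W = W"
    by (simp add: W matrix_transpose_mul transpose_diag transpose_scalar transpose_barrier_hessian
        matrix_mul_assoc)
  have "pucci_plus l L W \<le> - l * (s * r * (1 / 2 - T * b)) + L * CARD('n) * (s * r * (T * b))"
    using \<open>0 < l\<close> L s r T0 by (intro pucci_plus_le[OF _ _ sym up _ e low a]) auto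
  also have "\<dots> = s * r * (- (l / 2) + (l + L * CARD('n)) * (T * b))"
    by (simp add: algebra_simps)
  also have "\<dots> \<le> s * r * (- (l / 4))"
    using s r small' by (intro mult_left_mono) auto
  finally show ?thesis by (simp add: W_def r_def mult_ac)
qed

section \<open>Lipschitz dependence of the slope on the contact point\<close>

definition supporting_slope :: "(real ^ 'n) set \<Rightarrow> (real ^ 'n \<Rightarrow> real) \<Rightarrow> real ^ 'n \<Rightarrow> real ^ 'n \<Rightarrow> bool" where
  "supporting_slope \<Omega> u y \<xi> \<longleftrightarrow> y \<in> \<Omega> \<and> (\<forall>x\<in>\<Omega>. u x \<le> u y + \<xi> \<bullet> (x - y))"

definition slope_cube :: "real \<Rightarrow> (real ^ 'n) set" where
  "slope_cube R = cbox (\<chi> i. R) (\<chi> i. 2 * R)"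

lemma mem_slope_cube: "\<xi> \<in> slope_cube R \<longleftrightarrow> (\<forall>i. R \<le> \<xi> $ i \<and> \<xi> $ i \<le> 2 * R)"
  by (auto simp: slope_cube_def mem_box_cart)

text \<open>All slopes in the cube have components comparable to \<open>R\<close>, so the degenerate weights only scale
  the equation by \<open>R powr p\<close> and the constant is independent of \<open>R\<close>.\<close>

lemma supporting_slope_local_Lipschitz:
  fixes p l L :: real
  assumes "0 \<le> p" "0 < l" "l \<le> L"
  obtains C where "0 < C" and
    "\<And>(\<Omega> :: (real ^ 'n) set) f u (R :: real) y.
      \<lbrakk>open \<Omega>; continuous_on \<Omega> f; continuous_on \<Omega> u; visc_plus_ge p l L \<Omega> f u; 0 < R; y \<in> \<Omega>\<rbrakk> \<Longrightarrow>
      \<exists>\<delta>>0. \<forall>\<rho> z \<xi> \<zeta>. 0 < \<rho> \<longrightarrow> \<rho> < \<delta> \<longrightarrow> dist y z \<le> \<rho> \<longrightarrow> \<xi> \<in> slope_cube R \<longrightarrow>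
        supporting_slope \<Omega> u y \<xi> \<longrightarrow> supporting_slope \<Omega> u z \<zeta> \<longrightarrow>
        dist \<xi> \<zeta> \<le> \<rho> * (C * (neg_part f y / R powr p + R))"
proof -
  \<comment> \<open>For \<open>k = sqrt X\<close> the convexity \<open>b = 2 / k\<^sup>2\<close> of
    the barrier just meets the smallness condition of
    \<open>pucci_plus_weighted_barrier_le\<close>.\<close>
  define X where "X = 8 * (l + L * CARD('n)) * 6 powr p / l"
  have "8 * l * 1 \<le> 8 * (l + L * CARD('n)) * 6 powr p"
    using assms ge_one_powr_ge_zero[of 6 p] by (intro mult_mono) auto
  then have X: "8 \<le> X" using assms(2) by (simp add: X_def field_simps)
  define k where "k = sqrt X"
  have k_sq: "k\<^sup>2 = X" using X by (simp add: k_def)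
  have k: "2 \<le> k" unfolding k_def using X by (intro real_le_rsqrt) auto
  have pos: "(l + L * CARD('n)) * 6 powr p > 0"
    using assms by (intro mult_pos_pos add_pos_nonneg) auto
  have small: "(l + L * CARD('n)) * 6 powr p * (2 / k\<^sup>2) \<le> l / 4"
    unfolding k_sq X_def using pos assms(2) by (simp add: field_simps)
  \<comment> \<open>\<open>c2\<close> comes from \<open>norm q \<le> 3 * CARD('n) * R\<close> in the
    gradient term. In \<open>c3\<close> the first factor inverts the ellipticity factor
    \<open>l / (4 * 2 powr p)\<close>, and the 1 added to \<open>c2\<close> also covers the
    oscillation of \<open>f\<close> near \<open>y\<close>.\<close>
  define c2 where "c2 = L * (3 * real CARD('n)) powr (p + 1)"
  have c2: "c2 \<ge> 0" using assms by (simp add: c2_def)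
  define c3 where "c3 = 4 * 2 powr p / l * (1 + c2)"
  have c3: "c3 > 0" using assms c2 by (simp add: c3_def)
  show thesis
  proof (rule that[of "4 * c3"])
    show "0 < 4 * c3" using c3 by simp
  next
    fix \<Omega> :: "(real ^ 'n) set" and f u :: "real ^ 'n \<Rightarrow> real" and R :: real and y :: "real ^ 'n"
    assume "open \<Omega>" and f: "continuous_on \<Omega> f" and u: "continuous_on \<Omega> u"
      and visc: "visc_plus_ge p l L \<Omega> f u" and R: "0 < R" and y: "y \<in> \<Omega>"
    define m where "m = c3 * (neg_part f y / R powr p + R)"
    have F0: "neg_part f y \<ge> 0" by (simp add: neg_part_def)
    have m: "m > 0" unfolding m_def using c3 R F0 by (intro mult_pos_pos add_nonneg_pos) auto
    obtain \<epsilon>1 where e1: "\<epsilon>1 > 0" "ball y \<epsilon>1 \<subseteq> \<Omega>"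
      using \<open>open \<Omega>\<close> y open_contains_ball by blast
    obtain \<epsilon>2 where e2: "\<epsilon>2 > 0" "\<And>x. x \<in> \<Omega> \<Longrightarrow> dist x y < \<epsilon>2 \<Longrightarrow> dist (f x) (f y) < R powr (p + 1)"
      using f y R unfolding continuous_on_iff by (metis powr_gt_zero less_numeral_extra(3))
    \<comment> \<open>Three demands: the barrier region, of radius \<open>2 * k * \<rho>\<close>,
      stays inside \<open>\<Omega>\<close>; \<open>f\<close> varies there by less than
      \<open>R powr (p + 1)\<close>, the order of the gradient term; and
      \<open>2 * \<rho> * m < R / 4\<close>, so that the cap in \<open>\<eta>\<close> below is not
      attained.\<close>
    define \<delta> where "\<delta> = min (min \<epsilon>1 \<epsilon>2 / (4 * k)) (R / (8 * m))"
    have "\<delta> > 0" using e1 e2 k R m by (simp add: \<delta>_def)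
    moreover have "dist \<xi> \<zeta> \<le> \<rho> * (4 * m)"
      if \<rho>: "0 < \<rho>" "\<rho> < \<delta>" "dist y z \<le> \<rho>" and \<xi>: "\<xi> \<in> slope_cube R"
        and yz: "supporting_slope \<Omega> u y \<xi>" "supporting_slope \<Omega> u z \<zeta>" for \<rho> z \<xi> \<zeta>
    proof (cases "\<xi> = \<zeta>")
      case True
      then show ?thesis using \<rho>(1) m by simp
    next
      case False
      \<comment> \<open>The cap \<open>R / 4\<close> keeps the gradient \<open>q\<close> of the test
        function within \<open>R / 2\<close> of \<open>\<xi>\<close>, so its components stay between
        \<open>R / 2\<close> and \<open>3 * R\<close>. The resulting bound
        \<open>\<eta> \<le> 2 * \<rho> * m < R / 4\<close> shows that the minimum is its first
        entry.\<close>
      define \<eta> where "\<eta> = min (norm (\<zeta> - \<xi>) / 2) (R / 4)"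
      have \<eta>: "0 < \<eta>" "\<eta> \<le> norm (\<zeta> - \<xi>) / 2" "\<eta> \<le> R / 4"
        using False R by (auto simp: \<eta>_def)
      have "\<rho> < min \<epsilon>1 \<epsilon>2 / (4 * k)" using \<rho>(2) by (simp add: \<delta>_def)
      then have "k * (2 * \<rho>) < min \<epsilon>1 \<epsilon>2 / 2" using k by (simp add: field_simps)
      then have k\<rho>: "k * (2 * \<rho>) < \<epsilon>1" "k * (2 * \<rho>) < \<epsilon>2" using e1(1) e2(1) by linarith+
      have sub: "cball y (k * (2 * \<rho>)) \<subseteq> \<Omega>" using e1(2) k\<rho>(1) by (auto simp: subset_iff)
      \<comment> \<open>The barrier is used at scale \<open>2 * \<rho>\<close>, since it asks
        \<open>z\<close> to lie within half its scale of \<open>y\<close>.\<close>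
      have zy: "norm (z - y) \<le> 2 * \<rho> / 2" using \<rho>(3) by (simp add: dist_norm norm_minus_commute)
      obtain x q e where x: "x \<in> \<Omega>" "dist y x < k * (2 * \<rho>)" and q: "norm (q - \<xi>) \<le> 2 * \<eta>"
        and e: "norm e = 1"
        and ineq: "f x \<le> pucci_plus l L (weighted_hessian p q ((\<eta> / (2 * \<rho>)) *\<^sub>R barrier_hessian (2 / k\<^sup>2) e))
          + L * norm q powr (p + 1)"
        using visc_plus_ge_barrier[OF visc u _ _ _ _ _ zy k sub \<eta>(1,2)] yz \<rho>(1)
        unfolding supporting_slope_def by (metis mult_pos_pos zero_less_numeral)
      have q_i: "R / 2 \<le> q $ i \<and> q $ i \<le> 3 * R" for i
      proof -
        have "\<bar>q $ i - \<xi> $ i\<bar> \<le> R / 2"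
          using component_le_norm_cart[of "q - \<xi>" i] q \<eta>(3) by simp
        moreover have "R \<le> \<xi> $ i" "\<xi> $ i \<le> 2 * R" using \<xi> by (auto simp: mem_slope_cube)
        ultimately show ?thesis by linarith
      qed
      have "norm q \<le> (\<Sum>i\<in>UNIV. \<bar>q $ i\<bar>)" by (rule norm_le_l1_cart)
      also have "\<dots> \<le> (\<Sum>i\<in>(UNIV :: 'n set). 3 * R)"
      proof (rule sum_mono)
        fix i show "\<bar>q $ i\<bar> \<le> 3 * R" using q_i[of i] R by linarith
      qed
      finally have "norm q \<le> 3 * CARD('n) * R" by simp
      then have "norm q powr (p + 1) \<le> (3 * CARD('n) * R) powr (p + 1)"
        using assms(1) by (intro powr_mono2) auto
      also have "\<dots> = (3 * CARD('n)) powr (p + 1) * R powr (p + 1)"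
        using R by (intro powr_mult)
      finally have "L * norm q powr (p + 1) \<le> c2 * R powr (p + 1)"
        unfolding c2_def mult.assoc using assms by (intro mult_left_mono) auto
      moreover have "pucci_plus l L (weighted_hessian p q ((\<eta> / (2 * \<rho>)) *\<^sub>R barrier_hessian (2 / k\<^sup>2) e))
          \<le> - (l / 4) * (\<eta> / (2 * \<rho>)) * (R / 2) powr p"
        using \<eta>(1) \<rho>(1) by (intro pucci_plus_weighted_barrier_le[OF assms R q_i e _ _ small]) auto
      moreover have "- f x \<le> neg_part f y + R powr (p + 1)"
        using e2(2)[OF x(1)] x(2) k\<rho>(2)
        by (auto simp: dist_commute neg_part_def dist_real_def abs_if split: if_splits)
      ultimately have "(l / 4) * (\<eta> / (2 * \<rho>)) * (R / 2) powr p \<le> neg_part f y + (1 + c2) * R powr (p + 1)"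
        using ineq by (simp add: distrib_right)
      moreover have "(R / 2) powr p = R powr p / 2 powr p" using R by (simp add: powr_divide)
      moreover have "R powr (p + 1) = R powr p * R" using R by (simp add: powr_add)
      ultimately have "(l / 4) * (\<eta> / (2 * \<rho>)) * (R powr p / 2 powr p)
          \<le> neg_part f y + (1 + c2) * (R powr p * R)" by simp
      also have "\<dots> \<le> (1 + c2) * neg_part f y + (1 + c2) * (R powr p * R)"
        using F0 c2 by (simp add: distrib_right)
      also have "\<dots> = (l / 4) * m * (R powr p / 2 powr p)"
        using R assms(2) by (simp add: m_def c3_def field_simps)
      finally have "\<eta> / (2 * \<rho>) * (l / 4 * (R powr p / 2 powr p)) \<le> m * (l / 4 * (R powr p / 2 powr p))"
        by (simp only: mult_ac)
      moreover have "0 < l / 4 * (R powr p / 2 powr p)" using R assms(2) by simp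
      ultimately have "\<eta> / (2 * \<rho>) \<le> m" by (rule mult_right_le_imp_le)
      then have \<eta>_le: "\<eta> \<le> 2 * \<rho> * m" using \<rho>(1) by (simp add: field_simps)
      have "\<rho> < R / (8 * m)" using \<rho>(2) by (simp add: \<delta>_def)
      then have "2 * \<rho> * m < R / 4" using m by (simp add: field_simps)
      with \<eta>_le have "\<eta> = norm (\<zeta> - \<xi>) / 2" by (auto simp: \<eta>_def min_def split: if_splits)
      with \<eta>_le show ?thesis by (simp add: dist_norm norm_minus_commute)
    qed
    ultimately show "\<exists>\<delta>>0. \<forall>\<rho> z \<xi> \<zeta>. 0 < \<rho> \<longrightarrow> \<rho> < \<delta> \<longrightarrow> dist y z \<le> \<rho> \<longrightarrow> \<xi> \<in> slope_cube R \<longrightarrow>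
        supporting_slope \<Omega> u y \<xi> \<longrightarrow> supporting_slope \<Omega> u z \<zeta> \<longrightarrow>
        dist \<xi> \<zeta> \<le> \<rho> * (4 * c3 * (neg_part f y / R powr p + R))"
      unfolding m_def by (intro exI[of _ \<delta>]) (auto simp: mult.assoc)
  qed
qed

section \<open>Contact points\<close>

text \<open>A test function touching \<open>-u\<close> from above is the negative of one touching
  \<open>u\<close> from below. The weights depend only on the absolute values of the gradient
  components, so the weighted Hessian simply changes sign.\<close>

lemma visc_minus_le_imp_visc_plus_ge_uminus:
  fixes \<Omega> :: "(real ^ 'n) set"
  assumes "visc_minus_le p l L \<Omega> f u"
  shows "visc_plus_ge p l L \<Omega> (\<lambda>x. - f x) (\<lambda>x. - u x)"
  unfolding visc_plus_ge_def
proof (intro ballI allI impI)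
  fix x0 \<psi> G and H :: "real ^ 'n \<Rightarrow> real ^ 'n ^ 'n"
  assume "x0 \<in> \<Omega>" and C2: "C2_on \<Omega> \<psi> G H" and max: "local_max_at (\<lambda>x. - u x - \<psi> x) x0"
  have "C2_on \<Omega> (\<lambda>x. - \<psi> x) (\<lambda>x. - G x) (\<lambda>x. - H x)"
    unfolding C2_on_def
  proof (intro conjI ballI)
    fix x assume "x \<in> \<Omega>"
    then have "GDERIV \<psi> x :> G x" and G: "(G has_derivative (\<lambda>h. H x *v h)) (at x)"
      using C2 by (auto simp: C2_on_def)
    then show "GDERIV (\<lambda>x. - \<psi> x) x :> - G x" by (intro GDERIV_minus)
    have "(\<lambda>h. - H x *v h) = (\<lambda>h. - (H x *v h))"
      by (auto simp: vec_eq_iff matrix_vector_mult_def sum_negf)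
    then show "((\<lambda>x. - G x) has_derivative (\<lambda>h. - H x *v h)) (at x)"
      using has_derivative_minus[OF G] by simp
  qed (use C2 in \<open>auto simp: C2_on_def intro: continuous_on_minus\<close>)
  moreover have "local_min_at (\<lambda>x. u x - - \<psi> x) x0"
    using max by (simp add: local_max_at_def local_min_at_def algebra_simps)
  ultimately have "pucci_minus l L (weighted_hessian p (- G x0) (- H x0)) - L * norm (- G x0) powr (p + 1) \<le> f x0"
    using assms \<open>x0 \<in> \<Omega>\<close> unfolding visc_minus_le_def by blast
  moreover have "weighted_hessian p (- G x0) (- H x0) = - weighted_hessian p (G x0) (H x0)"
  proof -
    have "half_pow p (- s) = half_pow p s" for s by (simp add: half_pow_def)
    then show ?thesis
      by (simp add: weighted_hessian_def matrix_matrix_mult_def vec_eq_iff sum_negf)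
  qed
  ultimately show "- f x0 \<le> pucci_plus l L (weighted_hessian p (G x0) (H x0)) + L * norm (G x0) powr (p + 1)"
    by (simp add: pucci_minus_uminus)
qed

text \<open>Contact is required on the whole closure and slopes are confined to a closed cube, which
  makes the contact sets compact; \<open>contact_slope_interior\<close> leads back to
  \<open>\<Omega>\<close>.\<close>

definition contact_slope :: "(real ^ 'n) set \<Rightarrow> (real ^ 'n \<Rightarrow> real) \<Rightarrow> real \<Rightarrow> real ^ 'n \<Rightarrow> real ^ 'n \<Rightarrow> bool" where
  "contact_slope \<Omega> u R y \<xi> \<longleftrightarrow>
     y \<in> closure \<Omega> \<and> \<xi> \<in> slope_cube R \<and> (\<forall>x\<in>closure \<Omega>. u x \<le> u y + \<xi> \<bullet> (x - y))"

definition contact_points :: "(real ^ 'n) set \<Rightarrow> (real ^ 'n \<Rightarrow> real) \<Rightarrow> real \<Rightarrow> (real ^ 'n) set" where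
  "contact_points \<Omega> u R = {y. \<exists>\<xi>. contact_slope \<Omega> u R y \<xi>}"

text \<open>The pairs of point and slope are cut out of a compact product by closed conditions, one
  for each \<open>x\<close>, and the contact points are the projection of this compact set.\<close>

lemma compact_contact_points:
  fixes \<Omega> :: "(real ^ 'n) set"
  assumes "bounded \<Omega>" and u: "continuous_on (closure \<Omega>) u"
  shows "compact (contact_points \<Omega> u R)"
proof -
  let ?K = "closure \<Omega> \<times> (slope_cube R :: (real ^ 'n) set)"
  define Z where "Z x = {w \<in> ?K. u x \<le> u (fst w) + snd w \<bullet> (x - fst w)}" for x
  have K: "compact ?K"
    using \<open>bounded \<Omega>\<close> by (intro compact_Times) (auto simp: slope_cube_def compact_cbox)
  have "closed (Z x)" for x
    unfolding Z_def
  proof (rule continuous_on_closed_Collect_le)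
    show "continuous_on ?K (\<lambda>w. u (fst w) + snd w \<bullet> (x - fst w))"
      by (intro continuous_intros continuous_on_compose2[OF u]) auto
  qed (use K compact_imp_closed in auto)
  then have "compact (?K \<inter> (\<Inter>x\<in>closure \<Omega>. Z x))"
    by (intro compact_Int_closed K closed_INT) auto
  then have "compact (fst ` (?K \<inter> (\<Inter>x\<in>closure \<Omega>. Z x)))"
    by (intro compact_continuous_image continuous_intros)
  also have "fst ` (?K \<inter> (\<Inter>x\<in>closure \<Omega>. Z x)) = contact_points \<Omega> u R"
  proof (intro equalityI subsetI)
    fix y assume "y \<in> contact_points \<Omega> u R"
    then obtain \<xi> where "contact_slope \<Omega> u R y \<xi>" by (auto simp: contact_points_def)
    then have "(y, \<xi>) \<in> ?K \<inter> (\<Inter>x\<in>closure \<Omega>. Z x)"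
      by (auto simp: contact_slope_def Z_def)
    then show "y \<in> fst ` (?K \<inter> (\<Inter>x\<in>closure \<Omega>. Z x))" by (rule image_eqI[rotated]) simp
  qed (auto simp: contact_points_def contact_slope_def Z_def)
  finally show ?thesis .
qed

lemma norm_slope_cube_le:
  fixes \<xi> :: "real ^ 'n" and R :: real
  assumes "\<xi> \<in> slope_cube R" "0 < R"
  shows "norm \<xi> \<le> 2 * real CARD('n) * R"
proof -
  have "norm \<xi> \<le> (\<Sum>i\<in>UNIV. \<bar>\<xi> $ i\<bar>)" by (rule norm_le_l1_cart)
  also have "\<dots> \<le> (\<Sum>i\<in>(UNIV :: 'n set). 2 * R)"
  proof (rule sum_mono)
    fix i
    have "R \<le> \<xi> $ i" "\<xi> $ i \<le> 2 * R" using assms(1) by (auto simp: mem_slope_cube)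
    then show "\<bar>\<xi> $ i\<bar> \<le> 2 * R" using assms(2) by linarith
  qed
  finally show ?thesis by simp
qed

text \<open>A plane with slope in the cube that touched at a frontier point \<open>y\<close> would
  give \<open>u x0 \<le> u y + norm \<xi> * diameter \<Omega>\<close>, contradicting the gap
  \<open>bd\<close>.\<close>

lemma contact_slope_interior:
  fixes \<Omega> :: "(real ^ 'n) set" and R :: real
  assumes "open \<Omega>" "bounded \<Omega>" "0 < R" and x0: "x0 \<in> \<Omega>"
    and bd: "\<And>y. y \<in> frontier \<Omega> \<Longrightarrow> u y + 2 * real CARD('n) * R * diameter \<Omega> < u x0"
    and "contact_slope \<Omega> u R y \<xi>"
  shows "supporting_slope \<Omega> u y \<xi>"
proof -
  have y: "y \<in> closure \<Omega>" and \<xi>: "\<xi> \<in> slope_cube R"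
    and le: "\<And>x. x \<in> closure \<Omega> \<Longrightarrow> u x \<le> u y + \<xi> \<bullet> (x - y)"
    using assms(6) by (auto simp: contact_slope_def)
  have x0': "x0 \<in> closure \<Omega>" using x0 closure_subset by blast
  have "y \<in> \<Omega>"
  proof (rule ccontr)
    assume "y \<notin> \<Omega>"
    then have "y \<in> frontier \<Omega>" using y \<open>open \<Omega>\<close> by (simp add: frontier_def interior_open)
    have "dist x0 y \<le> diameter (closure \<Omega>)"
      using \<open>bounded \<Omega>\<close> x0' y by (intro diameter_bounded_bound) auto
    then have d: "norm (x0 - y) \<le> diameter \<Omega>"
      using \<open>bounded \<Omega>\<close> by (simp add: diameter_closure dist_norm)
    have "\<xi> \<bullet> (x0 - y) \<le> norm \<xi> * norm (x0 - y)" by (rule norm_cauchy_schwarz)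
    also have "\<dots> \<le> 2 * real CARD('n) * R * diameter \<Omega>"
      using norm_slope_cube_le[OF \<xi> \<open>0 < R\<close>] d \<open>0 < R\<close> by (intro mult_mono) auto
    finally show False using le[OF x0'] bd[OF \<open>y \<in> frontier \<Omega>\<close>] by linarith
  qed
  then show ?thesis using le closure_subset by (auto simp: supporting_slope_def)
qed

text \<open>A plane of slope \<open>\<xi>\<close> is lowered until it touches the graph:
  \<open>y\<close> maximizes \<open>u x - \<xi> \<bullet> x\<close> on the compact closure.\<close>

lemma contact_slope_exists:
  fixes \<Omega> :: "(real ^ 'n) set"
  assumes "bounded \<Omega>" "\<Omega> \<noteq> {}" and u: "continuous_on (closure \<Omega>) u" and "\<xi> \<in> slope_cube R"
  shows "\<exists>y. contact_slope \<Omega> u R y \<xi>"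
proof -
  have "continuous_on (closure \<Omega>) (\<lambda>x. u x - \<xi> \<bullet> x)"
    by (intro continuous_intros u)
  then obtain y where "y \<in> closure \<Omega>" "\<And>x. x \<in> closure \<Omega> \<Longrightarrow> u x - \<xi> \<bullet> x \<le> u y - \<xi> \<bullet> y"
    using continuous_attains_sup[of "closure \<Omega>" "\<lambda>x. u x - \<xi> \<bullet> x"] assms(1,2) by auto
  then have "contact_slope \<Omega> u R y \<xi>"
    using assms(4) by (auto simp: contact_slope_def inner_diff_right algebra_simps)
  then show ?thesis ..
qed

section \<open>Measure of the slopes, absorption of the gradient term, and the supremum
  bound\<close>

lemma emeasure_slope_cube:
  fixes R :: real
  assumes "0 < R"
  shows "emeasure lborel (slope_cube R :: (real ^ 'n) set) = ennreal (R ^ CARD('n))"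
proof -
  have *: "(\<chi> i. c) \<bullet> b = c" if "b \<in> Basis" for b :: "real ^ 'n" and c :: real
    using that by (auto simp: Basis_vec_def inner_axis)
  have "emeasure lborel (slope_cube R :: (real ^ 'n) set)
      = ennreal (\<Prod>b\<in>(Basis :: (real ^ 'n) set). ((\<chi> i. 2 * R) - (\<chi> i. R)) \<bullet> b)"
    unfolding slope_cube_def using assms by (intro emeasure_lborel_cbox) (simp add: *)
  also have "(\<Prod>b\<in>(Basis :: (real ^ 'n) set). ((\<chi> i. 2 * R) - (\<chi> i. R)) \<bullet> b) = R ^ CARD('n)"
    by (simp add: inner_diff_left * cong: prod.cong_simp)
  finally show ?thesis .
qed

lemma power_add_le: "(a + b) ^ n \<le> 2 ^ n * (a ^ n + b ^ n)" if "0 \<le> a" "0 \<le> b" for a b :: real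
proof -
  have "(a + b) ^ n \<le> (2 * max a b) ^ n" using that by (intro power_mono) auto
  also have "\<dots> = 2 ^ n * (max a b) ^ n" by (simp add: power_mult_distrib)
  also have "\<dots> \<le> 2 ^ n * (a ^ n + b ^ n)"
    using that by (intro mult_left_mono) (auto simp: max_def)
  finally show ?thesis .
qed

text \<open>The Lipschitz bound with both contact points equal to \<open>y\<close> holds for every
  small \<open>\<rho>\<close>, and letting \<open>\<rho>\<close> tend to 0 forces the slopes to
  coincide. This makes contact sets belonging to disjoint slope cubes disjoint.\<close>

lemma supporting_slope_unique:
  fixes \<Omega> :: "(real ^ 'n) set" and p l L R :: real
  assumes "0 \<le> p" "0 < l" "l \<le> L" and "open \<Omega>" "continuous_on \<Omega> f" "continuous_on \<Omega> u"
    "visc_plus_ge p l L \<Omega> f u" "0 < R"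
    and \<xi>: "\<xi> \<in> slope_cube R" "supporting_slope \<Omega> u y \<xi>" and \<zeta>: "supporting_slope \<Omega> u y \<zeta>"
  shows "\<xi> = \<zeta>"
proof -
  have "y \<in> \<Omega>" using \<xi>(2) by (simp add: supporting_slope_def)
  obtain C :: real and \<delta> where \<delta>: "\<delta> > 0"
    "\<And>\<rho>. \<lbrakk>0 < \<rho>; \<rho> < \<delta>\<rbrakk> \<Longrightarrow> dist \<xi> \<zeta> \<le> \<rho> * (C * (neg_part f y / R powr p + R))"
  proof (rule supporting_slope_local_Lipschitz[OF assms(1-3), where 'n = 'n])
    fix C :: real
    assume *: "\<And>(\<Omega> :: (real ^ 'n) set) f u (R :: real) y.
      \<lbrakk>open \<Omega>; continuous_on \<Omega> f; continuous_on \<Omega> u; visc_plus_ge p l L \<Omega> f u; 0 < R; y \<in> \<Omega>\<rbrakk> \<Longrightarrow>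
      \<exists>\<delta>>0. \<forall>\<rho> z \<xi> \<zeta>. 0 < \<rho> \<longrightarrow> \<rho> < \<delta> \<longrightarrow> dist y z \<le> \<rho> \<longrightarrow> \<xi> \<in> slope_cube R \<longrightarrow>
        supporting_slope \<Omega> u y \<xi> \<longrightarrow> supporting_slope \<Omega> u z \<zeta> \<longrightarrow>
        dist \<xi> \<zeta> \<le> \<rho> * (C * (neg_part f y / R powr p + R))"
    from *[OF assms(4-8) \<open>y \<in> \<Omega>\<close>] obtain \<delta> where "\<delta> > 0"
      and **: "\<And>\<rho> z \<xi> \<zeta>. \<lbrakk>0 < \<rho>; \<rho> < \<delta>; dist y z \<le> \<rho>; \<xi> \<in> slope_cube R; supporting_slope \<Omega> u y \<xi>;
        supporting_slope \<Omega> u z \<zeta>\<rbrakk> \<Longrightarrow> dist \<xi> \<zeta> \<le> \<rho> * (C * (neg_part f y / R powr p + R))"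
      by blast
    from \<open>\<delta> > 0\<close> show thesis
      by (rule that[of \<delta> C]) (use **[of _ y \<xi> \<zeta>] \<xi> \<zeta> in simp)
  qed
  define B where "B = C * (neg_part f y / R powr p + R)"
  have "((\<lambda>\<rho>. \<rho> * B) \<longlongrightarrow> 0 * B) (at_right 0)"
    by (intro tendsto_intros)
  moreover have "\<forall>\<^sub>F \<rho> in at_right 0. dist \<xi> \<zeta> \<le> \<rho> * B"
    using \<delta> unfolding B_def eventually_at_right_field by (intro exI[of _ \<delta>]) auto
  ultimately have "dist \<xi> \<zeta> \<le> 0"
    by (intro tendsto_lowerbound[of "\<lambda>\<rho>. \<rho> * B" 0 "at_right 0"]) auto
  then show ?thesis by simp
qed

text \<open>Every slope in the cube is attained at some contact point, so the covering estimate
  bounds the measure of the whole cube, with Lipschitz constant \<open>g\<close>. The two summands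
  of \<open>g\<close> are then separated: the term with \<open>f\<close> is integrated over the
  upper contact set, while the gradient term keeps the measure of the contact points, which is made
  small later.\<close>

lemma slope_cube_measure_estimate:
  fixes p l L :: real
  assumes "0 \<le> p" "0 < l" "l \<le> L"
  obtains C where "0 < C" and
    "\<And>(\<Omega> :: (real ^ 'n) set) f u (R :: real) x0.
      \<lbrakk>open \<Omega>; bounded \<Omega>; continuous_on \<Omega> f; continuous_on (closure \<Omega>) u; visc_plus_ge p l L \<Omega> f u;
        0 < R; x0 \<in> \<Omega>; \<And>y. y \<in> frontier \<Omega> \<Longrightarrow> u y + 2 * real CARD('n) * R * diameter \<Omega> < u x0\<rbrakk> \<Longrightarrow>
      ennreal (R ^ CARD('n)) \<le> ennreal C *
        (ennreal (1 / (R powr p) ^ CARD('n)) *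
           (\<integral>\<^sup>+x\<in>upper_contact_set \<Omega> u. ennreal (neg_part f x ^ CARD('n)) \<partial>lborel)
         + ennreal (R ^ CARD('n)) * emeasure lborel (contact_points \<Omega> u R))"
proof (rule supporting_slope_local_Lipschitz[OF assms, where 'n = 'n])
  let ?n = "CARD('n)"
  fix C :: real
  assume C: "0 < C" and Lip:
    "\<And>(\<Omega> :: (real ^ 'n) set) f u (R :: real) y.
      \<lbrakk>open \<Omega>; continuous_on \<Omega> f; continuous_on \<Omega> u; visc_plus_ge p l L \<Omega> f u; 0 < R; y \<in> \<Omega>\<rbrakk> \<Longrightarrow>
      \<exists>\<delta>>0. \<forall>\<rho> z \<xi> \<zeta>. 0 < \<rho> \<longrightarrow> \<rho> < \<delta> \<longrightarrow> dist y z \<le> \<rho> \<longrightarrow> \<xi> \<in> slope_cube R \<longrightarrow>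
        supporting_slope \<Omega> u y \<xi> \<longrightarrow> supporting_slope \<Omega> u z \<zeta> \<longrightarrow>
        dist \<xi> \<zeta> \<le> \<rho> * (C * (neg_part f y / R powr p + R))"
  define c where "c = (4 * sqrt ?n) ^ ?n"
  have c: "c > 0" by (simp add: c_def)
  define D where "D = C ^ ?n * 2 ^ ?n"
  have D: "D > 0" using C by (simp add: D_def)
  show thesis
  proof (rule that[of "c * D"])
    show "0 < c * D" using c D by simp
  next
    fix \<Omega> :: "(real ^ 'n) set" and f u :: "real ^ 'n \<Rightarrow> real" and R :: real and x0
    assume \<Omega>: "open \<Omega>" "bounded \<Omega>" and f: "continuous_on \<Omega> f"
      and u: "continuous_on (closure \<Omega>) u" and visc: "visc_plus_ge p l L \<Omega> f u" and R: "0 < R"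
      and x0: "x0 \<in> \<Omega>" and bd: "\<And>y. y \<in> frontier \<Omega> \<Longrightarrow> u y + 2 * real ?n * R * diameter \<Omega> < u x0"
    define S where "S = contact_points \<Omega> u R"
    define F where "F = neg_part f"
    define g where "g x = C * (F x / R powr p + R)" for x
    have F0: "0 \<le> F x" for x by (simp add: F_def neg_part_def)
    have F: "continuous_on \<Omega> F" unfolding F_def neg_part_def by (intro continuous_intros f)
    have u': "continuous_on \<Omega> u" using u closure_subset by (rule continuous_on_subset)
    have supp: "supporting_slope \<Omega> u y \<xi>" if "contact_slope \<Omega> u R y \<xi>" for y \<xi>
      using contact_slope_interior[OF \<Omega> R x0 bd that] .
    have S: "compact S" unfolding S_def using \<Omega>(2) u by (rule compact_contact_points)
    have Sb: "S \<in> sets borel" using S by (simp add: borel_compact)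
    have S\<Omega>: "S \<subseteq> \<Omega>"
      using supp by (auto simp: S_def contact_points_def supporting_slope_def)
    have S_contact: "S \<subseteq> upper_contact_set \<Omega> u"
      using supp by (fastforce simp: S_def contact_points_def supporting_slope_def upper_contact_set_def)
    have "emeasure lborel (slope_cube R :: (real ^ 'n) set)
        \<le> ennreal ((4 * sqrt DIM(real ^ 'n)) ^ DIM(real ^ 'n)) * (\<integral>\<^sup>+x\<in>S. ennreal (g x ^ DIM(real ^ 'n)) \<partial>lborel)"
    proof (rule emeasure_le_nn_integral_compact[OF S S\<Omega> \<Omega>(1)])
      show "continuous_on \<Omega> g" unfolding g_def using R by (intro continuous_intros F) auto
      show "0 < g x" for x unfolding g_def using C R F0[of x] by (intro mult_pos_pos add_nonneg_pos) auto
      show "\<exists>y\<in>S. contact_slope \<Omega> u R y \<xi>" if "\<xi> \<in> slope_cube R" for \<xi>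
        using contact_slope_exists[OF \<Omega>(2) _ u that] x0 by (auto simp: S_def contact_points_def)
      show "\<exists>\<xi>. contact_slope \<Omega> u R y \<xi>" if "y \<in> S" for y
        using that by (simp add: S_def contact_points_def)
      fix y assume "y \<in> S"
      then have "y \<in> \<Omega>" using S\<Omega> by blast
      from Lip[OF \<Omega>(1) f u' visc R this]
      obtain \<delta> where "\<delta> > 0" and *: "\<And>\<rho> z \<xi> \<zeta>. \<lbrakk>0 < \<rho>; \<rho> < \<delta>; dist y z \<le> \<rho>; \<xi> \<in> slope_cube R;
          supporting_slope \<Omega> u y \<xi>; supporting_slope \<Omega> u z \<zeta>\<rbrakk> \<Longrightarrow> dist \<xi> \<zeta> \<le> \<rho> * g y"
        unfolding g_def F_def by blast
      moreover have "\<xi> \<in> slope_cube R" if "contact_slope \<Omega> u R y \<xi>" for \<xi>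
        using that by (simp add: contact_slope_def)
      ultimately show "\<exists>\<delta>>0. \<forall>\<rho> z \<xi> \<zeta>. 0 < \<rho> \<longrightarrow> \<rho> < \<delta> \<longrightarrow> z \<in> S \<longrightarrow> dist y z \<le> \<rho> \<longrightarrow>
          contact_slope \<Omega> u R y \<xi> \<longrightarrow> contact_slope \<Omega> u R z \<zeta> \<longrightarrow> dist \<xi> \<zeta> \<le> \<rho> * g y"
        using supp by blast
    qed
    then have "ennreal (R ^ ?n) \<le> ennreal c * (\<integral>\<^sup>+x\<in>S. ennreal (g x ^ ?n) \<partial>lborel)"
      by (simp add: emeasure_slope_cube[OF R] c_def)
    also have "(\<integral>\<^sup>+x\<in>S. ennreal (g x ^ ?n) \<partial>lborel)
        \<le> (\<integral>\<^sup>+x. ennreal (D / (R powr p) ^ ?n) * (ennreal (F x ^ ?n) * indicator S x)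
              + ennreal (D * R ^ ?n) * indicator S x \<partial>lborel)"
    proof (rule nn_integral_mono)
      fix x
      have "g x ^ ?n \<le> C ^ ?n * (2 ^ ?n * ((F x / R powr p) ^ ?n + R ^ ?n))"
        unfolding g_def power_mult_distrib using C R F0[of x] by (intro mult_left_mono power_add_le) auto
      also have "\<dots> = D / (R powr p) ^ ?n * F x ^ ?n + D * R ^ ?n"
        by (simp add: D_def power_divide algebra_simps)
      finally have "ennreal (g x ^ ?n) \<le> ennreal (D / (R powr p) ^ ?n * F x ^ ?n + D * R ^ ?n)"
        by (rule ennreal_leI)
      also have "\<dots> = ennreal (D / (R powr p) ^ ?n) * ennreal (F x ^ ?n) + ennreal (D * R ^ ?n)"
      proof -
        have "0 \<le> D / (R powr p) ^ ?n" "0 \<le> F x ^ ?n" "0 \<le> D * R ^ ?n"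
          using D R F0[of x] by simp_all
        then show ?thesis by (simp only: ennreal_plus ennreal_mult mult_nonneg_nonneg)
      qed
      finally show "ennreal (g x ^ ?n) * indicator S x
          \<le> ennreal (D / (R powr p) ^ ?n) * (ennreal (F x ^ ?n) * indicator S x)
              + ennreal (D * R ^ ?n) * indicator S x"
        by (simp add: indicator_def)
    qed
    also have "\<dots> = ennreal (D / (R powr p) ^ ?n) * (\<integral>\<^sup>+x\<in>S. ennreal (F x ^ ?n) \<partial>lborel)
        + ennreal (D * R ^ ?n) * emeasure lborel S"
    proof -
      have [measurable]: "(\<lambda>x. ennreal (F x ^ ?n) * indicator S x) \<in> borel_measurable lborel"
        using Sb F S\<Omega> by (intro borel_measurable_ennreal_indicator continuous_intros) (auto intro: continuous_on_subset)
      show ?thesis using Sb by (simp add: nn_integral_add nn_integral_cmult nn_integral_cmult_indicator)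
    qed
    also have "\<dots> \<le> ennreal (D / (R powr p) ^ ?n) * (\<integral>\<^sup>+x\<in>upper_contact_set \<Omega> u. ennreal (F x ^ ?n) \<partial>lborel)
        + ennreal (D * R ^ ?n) * emeasure lborel S"
      using S_contact by (intro add_right_mono mult_left_mono nn_integral_mono) (auto simp: indicator_def)
    also have "\<dots> = ennreal D * (ennreal (1 / (R powr p) ^ ?n) * (\<integral>\<^sup>+x\<in>upper_contact_set \<Omega> u. ennreal (F x ^ ?n) \<partial>lborel)
        + ennreal (R ^ ?n) * emeasure lborel S)"
    proof -
      have "ennreal (D / (R powr p) ^ ?n) = ennreal D * ennreal (1 / (R powr p) ^ ?n)"
        "ennreal (D * R ^ ?n) = ennreal D * ennreal (R ^ ?n)"
        using D R by (simp_all flip: ennreal_mult')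
      then show ?thesis by (simp only: distrib_left mult.assoc)
    qed
    finally have "ennreal (R ^ ?n) \<le> ennreal c * (ennreal D * (ennreal (1 / (R powr p) ^ ?n) *
        (\<integral>\<^sup>+x\<in>upper_contact_set \<Omega> u. ennreal (F x ^ ?n) \<partial>lborel) + ennreal (R ^ ?n) * emeasure lborel S))"
      by (simp add: mult_left_mono)
    moreover have "ennreal (c * D) = ennreal c * ennreal D" using c D by (simp add: ennreal_mult')
    ultimately show "ennreal (R ^ ?n) \<le> ennreal (c * D) *
        (ennreal (1 / (R powr p) ^ ?n) *
           (\<integral>\<^sup>+x\<in>upper_contact_set \<Omega> u. ennreal (neg_part f x ^ ?n) \<partial>lborel)
         + ennreal (R ^ ?n) * emeasure lborel (contact_points \<Omega> u R))"
      by (simp only: F_def S_def mult.assoc)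
  qed
qed

lemma emeasure_bounded_le:
  fixes \<Omega> :: "(real ^ 'n) set"
  assumes "bounded \<Omega>"
  shows "emeasure lborel \<Omega> \<le> ennreal ((2 * diameter \<Omega>) ^ CARD('n))"
proof (cases "\<Omega> = {}")
  case False
  then obtain x0 where x0: "x0 \<in> \<Omega>" by blast
  let ?d = "diameter \<Omega>"
  have d: "0 \<le> ?d" using assms by (rule diameter_ge_0)
  have "\<Omega> \<subseteq> cbox (x0 - ?d *\<^sub>R One) (x0 + ?d *\<^sub>R One)"
  proof
    fix x assume "x \<in> \<Omega>"
    then have "norm (x - x0) \<le> ?d"
      using diameter_bounded_bound[OF assms _ x0] by (simp add: dist_norm)
    then have "x0 \<bullet> b - ?d \<le> x \<bullet> b \<and> x \<bullet> b \<le> x0 \<bullet> b + ?d" if "b \<in> Basis" for b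
      using Basis_le_norm[OF that, of "x - x0"] by (auto simp: inner_diff_left abs_le_iff)
    then show "x \<in> cbox (x0 - ?d *\<^sub>R One) (x0 + ?d *\<^sub>R One)"
      by (auto simp: mem_box inner_simps)
  qed
  then have "emeasure lborel \<Omega> \<le> emeasure lborel (cbox (x0 - ?d *\<^sub>R One) (x0 + ?d *\<^sub>R One))"
    by (intro emeasure_mono) auto
  also have "\<dots> = ennreal (\<Prod>b\<in>Basis. ((x0 + ?d *\<^sub>R One) - (x0 - ?d *\<^sub>R One)) \<bullet> b)"
    using d by (intro emeasure_lborel_cbox) (auto simp: inner_simps)
  also have "(\<Prod>b\<in>Basis. ((x0 + ?d *\<^sub>R One) - (x0 - ?d *\<^sub>R One)) \<bullet> b)
      = (\<Prod>b\<in>(Basis :: (real ^ 'n) set). 2 * ?d)"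
    by (intro prod.cong refl) (simp only: inner_diff_left inner_add_left, simp)
  finally show ?thesis by simp
qed simp

text \<open>Pigeonhole over scales: by uniqueness of slopes the contact sets are disjoint subsets of
  \<open>\<Omega>\<close>, so not all \<open>N\<close> of them can have measure at least
  \<open>c\<close> when \<open>N * c\<close> exceeds \<open>V\<close>.\<close>

lemma exists_small_contact_points:
  fixes p l L V c R :: real and \<Omega> :: "(real ^ 'n) set"
  assumes "0 \<le> p" "0 < l" "l \<le> L"
    and \<Omega>: "open \<Omega>" "bounded \<Omega>" and "continuous_on \<Omega> f" "continuous_on (closure \<Omega>) u"
    and visc: "visc_plus_ge p l L \<Omega> f u" and R: "0 < R" and x0: "x0 \<in> \<Omega>"
    and bd: "\<And>y. y \<in> frontier \<Omega> \<Longrightarrow> u y + 2 * real CARD('n) * R * diameter \<Omega> < u x0"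
    and V: "emeasure lborel \<Omega> \<le> ennreal V" "0 \<le> V" and c: "0 < c" "V < real N * c"
  shows "\<exists>k<N. emeasure lborel (contact_points \<Omega> u (R / 4 ^ k)) \<le> ennreal c"
proof (rule ccontr)
  assume "\<not> ?thesis"
  then have large: "ennreal c \<le> emeasure lborel (contact_points \<Omega> u (R / 4 ^ k))" if "k < N" for k
    using that by (auto simp: not_le intro: less_imp_le)
  let ?\<Gamma> = "\<lambda>k. contact_points \<Omega> u (R / 4 ^ k)"
  have R': "0 < R / 4 ^ k" for k :: nat using R by simp
  have u: "continuous_on \<Omega> u" using assms(7) closure_subset by (rule continuous_on_subset)
  have supp: "supporting_slope \<Omega> u y \<xi>" if "contact_slope \<Omega> u (R / 4 ^ k) y \<xi>" for y \<xi> k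
  proof (rule contact_slope_interior[OF \<Omega> R' x0 _ that])
    fix y assume "y \<in> frontier \<Omega>"
    have "R / 4 ^ k \<le> R / 1" using R by (intro divide_left_mono) auto
    then have "2 * real CARD('n) * (R / 4 ^ k) * diameter \<Omega> \<le> 2 * real CARD('n) * R * diameter \<Omega>"
      using diameter_ge_0[OF \<Omega>(2)] by (intro mult_right_mono mult_left_mono) auto
    then show "u y + 2 * real CARD('n) * (R / 4 ^ k) * diameter \<Omega> < u x0"
      using bd[OF \<open>y \<in> frontier \<Omega>\<close>] by linarith
  qed
  have "?\<Gamma> j \<inter> ?\<Gamma> k = {}" if "j < k" for j k
  proof (rule ccontr)
    assume "?\<Gamma> j \<inter> ?\<Gamma> k \<noteq> {}"
    then obtain y \<xi> \<zeta> where *: "contact_slope \<Omega> u (R / 4 ^ j) y \<xi>" "contact_slope \<Omega> u (R / 4 ^ k) y \<zeta>"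
      by (auto simp: contact_points_def)
    then have cubes: "\<xi> \<in> slope_cube (R / 4 ^ j)" "\<zeta> \<in> slope_cube (R / 4 ^ k)"
      by (auto simp: contact_slope_def)
    have "\<xi> = \<zeta>"
      by (rule supporting_slope_unique[OF assms(1-3) \<Omega>(1) assms(6) u visc R' cubes(1) supp[OF *(1)] supp[OF *(2)]])
    \<comment> \<open>A cube reaches only up to twice its scale, so the ratio 4 between consecutive
      scales keeps the cubes apart.\<close>
    then have "R / 4 ^ j \<le> 2 * (R / 4 ^ k)"
      using cubes by (auto simp: mem_slope_cube intro: order_trans)
    then have "(4 :: real) ^ k \<le> 2 * 4 ^ j" using R by (simp add: field_simps)
    moreover have "(4 :: real) ^ Suc j \<le> 4 ^ k" using that by (intro power_increasing) auto
    moreover have "(0 :: real) < 4 ^ j" by simp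
    ultimately show False unfolding power_Suc by linarith
  qed
  then have disj: "disjoint_family_on ?\<Gamma> {..<N}"
    unfolding disjoint_family_on_def by (metis inf_commute nat_neq_iff)
  have sets: "?\<Gamma> k \<in> sets lborel" for k
    using compact_contact_points[OF \<Omega>(2) assms(7)] by (simp add: borel_compact)
  have sub: "(\<Union>k<N. ?\<Gamma> k) \<subseteq> \<Omega>"
    using supp by (fastforce simp: contact_points_def supporting_slope_def)
  have "ennreal (real N * c) = (\<Sum>k<N. ennreal c)"
    using c(1) by (simp add: ennreal_mult' ennreal_of_nat_eq_real_of_nat)
  also have "\<dots> \<le> (\<Sum>k<N. emeasure lborel (?\<Gamma> k))"
    using large by (intro sum_mono) auto
  also have "\<dots> = emeasure lborel (\<Union>k<N. ?\<Gamma> k)"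
    using sets disj by (intro sum_emeasure) auto
  also have "\<dots> \<le> emeasure lborel \<Omega>"
    using sub \<Omega>(1) by (intro emeasure_mono) auto
  also have "\<dots> \<le> ennreal V" by (rule V(1))
  finally show False using c V(2) by (simp add: ennreal_le_iff)
qed

text \<open>At a scale \<open>r = R / 4 ^ k\<close> where the gradient term is at most
  \<open>r ^ n / 2\<close>, absorbing it leaves \<open>r powr (n * (1 + p)) \<le> 2 * C * K\<close>.
  Returning from \<open>r\<close> to \<open>R\<close> costs at most the factor
  \<open>4 ^ N\<close>.\<close>

lemma slope_bound:
  fixes p l L d :: real
  assumes p: "0 \<le> p" "0 < l" "l \<le> L" and d: "0 < d"
  obtains A where "0 < A" and
    "\<And>(\<Omega> :: (real ^ 'n) set) f u (R :: real) x0 K.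
      \<lbrakk>open \<Omega>; bounded \<Omega>; diameter \<Omega> = d; continuous_on \<Omega> f; continuous_on (closure \<Omega>) u;
        visc_plus_ge p l L \<Omega> f u; 0 < R; x0 \<in> \<Omega>;
        \<And>y. y \<in> frontier \<Omega> \<Longrightarrow> u y + 2 * real CARD('n) * R * d < u x0;
        0 \<le> K; (\<integral>\<^sup>+x\<in>upper_contact_set \<Omega> u. ennreal (neg_part f x ^ CARD('n)) \<partial>lborel) = ennreal K\<rbrakk> \<Longrightarrow>
      R \<le> A * K powr (1 / (real CARD('n) * (1 + p)))"
proof (rule slope_cube_measure_estimate[OF p, where 'n = 'n])
  let ?n = "CARD('n)"
  fix C :: real
  assume C: "0 < C" and est:
    "\<And>(\<Omega> :: (real ^ 'n) set) f u (R :: real) x0.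
      \<lbrakk>open \<Omega>; bounded \<Omega>; continuous_on \<Omega> f; continuous_on (closure \<Omega>) u; visc_plus_ge p l L \<Omega> f u;
        0 < R; x0 \<in> \<Omega>; \<And>y. y \<in> frontier \<Omega> \<Longrightarrow> u y + 2 * real CARD('n) * R * diameter \<Omega> < u x0\<rbrakk> \<Longrightarrow>
      ennreal (R ^ CARD('n)) \<le> ennreal C *
        (ennreal (1 / (R powr p) ^ CARD('n)) *
           (\<integral>\<^sup>+x\<in>upper_contact_set \<Omega> u. ennreal (neg_part f x ^ CARD('n)) \<partial>lborel)
         + ennreal (R ^ CARD('n)) * emeasure lborel (contact_points \<Omega> u R))"
  define V where "V = (2 * d) ^ ?n"
  have V: "0 \<le> V" using d by (simp add: V_def)
  \<comment> \<open>This value turns \<open>C * (r ^ n * c)\<close> into \<open>r ^ n / 2\<close>.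
    \<open>N\<close> is fixed before the domain and the functions, so the final constant is uniform
    in them.\<close>
  define c where "c = 1 / (2 * C)"
  have c: "0 < c" using C by (simp add: c_def)
  obtain N :: nat where N: "V < real N * c" using reals_Archimedean3[OF c] by blast
  define a where "a = real ?n * (1 + p)"
  have a: "0 < a" using p(1) by (simp add: a_def)
  show thesis
  proof (rule that[of "4 ^ N * (2 * C) powr (1 / a)"])
    show "0 < 4 ^ N * (2 * C) powr (1 / a)" using C by simp
  next
    fix \<Omega> :: "(real ^ 'n) set" and f u :: "real ^ 'n \<Rightarrow> real" and R K :: real and x0
    assume \<Omega>: "open \<Omega>" "bounded \<Omega>" "diameter \<Omega> = d" and f: "continuous_on \<Omega> f"
      and u: "continuous_on (closure \<Omega>) u" and visc: "visc_plus_ge p l L \<Omega> f u" and R: "0 < R"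
      and x0: "x0 \<in> \<Omega>" and bd: "\<And>y. y \<in> frontier \<Omega> \<Longrightarrow> u y + 2 * real ?n * R * d < u x0"
      and K: "0 \<le> K"
      and int: "(\<integral>\<^sup>+x\<in>upper_contact_set \<Omega> u. ennreal (neg_part f x ^ ?n) \<partial>lborel) = ennreal K"
    have bd': "u y + 2 * real ?n * R * diameter \<Omega> < u x0" if "y \<in> frontier \<Omega>" for y
      using bd[OF that] by (simp add: \<Omega>(3))
    have "emeasure lborel \<Omega> \<le> ennreal V"
      using emeasure_bounded_le[OF \<Omega>(2)] by (simp add: V_def \<Omega>(3))
    from exists_small_contact_points[OF p \<Omega>(1,2) f u visc R x0 bd' this V c N]
    obtain k where k: "k < N" and small: "emeasure lborel (contact_points \<Omega> u (R / 4 ^ k)) \<le> ennreal c"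
      by blast
    define r where "r = R / 4 ^ k"
    have r: "0 < r" using R by (simp add: r_def)
    have "r \<le> R / 1" unfolding r_def using R by (intro divide_left_mono) auto
    then have "2 * real ?n * r * d \<le> 2 * real ?n * R * d"
      using d by (intro mult_right_mono mult_left_mono) auto
    then have bd_r: "u y + 2 * real ?n * r * diameter \<Omega> < u x0" if "y \<in> frontier \<Omega>" for y
      using bd'[OF that] unfolding \<Omega>(3) by linarith
    have "ennreal (r ^ ?n) \<le> ennreal C * (ennreal (1 / (r powr p) ^ ?n) * ennreal K
        + ennreal (r ^ ?n) * emeasure lborel (contact_points \<Omega> u r))"
      using est[OF \<Omega>(1,2) f u visc r x0 bd_r] by (simp only: int)
    also have "\<dots> \<le> ennreal C * (ennreal (1 / (r powr p) ^ ?n) * ennreal K + ennreal (r ^ ?n) * ennreal c)"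
      using small by (intro mult_left_mono add_left_mono) (auto simp: r_def)
    also have "\<dots> = ennreal (C * (1 / (r powr p) ^ ?n * K + r ^ ?n * c))"
    proof -
      have "0 \<le> C" "0 \<le> 1 / (r powr p) ^ ?n" "0 \<le> r ^ ?n" "0 \<le> c" using C r c by simp_all
      with K show ?thesis by (simp only: ennreal_plus ennreal_mult mult_nonneg_nonneg add_nonneg_nonneg)
    qed
    finally have "r ^ ?n \<le> C * (1 / (r powr p) ^ ?n * K + r ^ ?n * c)"
      using C K r c by (subst (asm) ennreal_le_iff) auto
    also have "\<dots> = C * K / (r powr p) ^ ?n + r ^ ?n / 2"
      using C by (simp add: c_def algebra_simps)
    finally have "r ^ ?n \<le> 2 * C * K / (r powr p) ^ ?n" by simp
    then have "r ^ ?n * (r powr p) ^ ?n \<le> 2 * C * K"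
      using r by (simp add: field_simps)
    also have "r ^ ?n * (r powr p) ^ ?n = (r powr (1 + p)) ^ ?n"
      using r by (simp add: power_mult_distrib powr_add)
    also have "\<dots> = (r powr (1 + p)) powr real ?n"
      using r by (intro powr_realpow[symmetric]) simp
    also have "\<dots> = r powr a"
      by (simp add: a_def powr_powr mult.commute)
    finally have "(r powr a) powr (1 / a) \<le> (2 * C * K) powr (1 / a)"
      using a by (intro powr_mono2) auto
    then have "r \<le> (2 * C) powr (1 / a) * K powr (1 / a)"
      using a r C K by (simp add: powr_powr powr_mult)
    then have "4 ^ k * r \<le> 4 ^ N * ((2 * C) powr (1 / a) * K powr (1 / a))"
      using k r by (intro mult_mono power_increasing) auto
    then show "R \<le> 4 ^ N * (2 * C) powr (1 / a) * K powr (1 / (real ?n * (1 + p)))"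
      by (simp add: r_def a_def mult.assoc)
  qed
qed

text \<open>If \<open>u x0\<close> exceeded the bound, some \<open>R\<close> above the slope bound
  would still satisfy the boundary gap required there. The constant \<open>C = 2 * n * d * A\<close>
  converts slopes into heights across the diameter \<open>d\<close>.\<close>

lemma sup_bound:
  fixes p l L d :: real
  assumes p: "0 \<le> p" "0 < l" "l \<le> L" and d: "0 < d"
  shows "\<exists>C>0. \<forall>(\<Omega> :: (real ^ 'n) set) f u.
    open \<Omega> \<and> \<Omega> \<noteq> {} \<and> bounded \<Omega> \<and> diameter \<Omega> = d \<and>
    continuous_on \<Omega> f \<and> continuous_on (closure \<Omega>) u \<and> visc_plus_ge p l L \<Omega> f u \<longrightarrow>
      (SUP x\<in>\<Omega>. ereal (u x)) \<le> (SUP x\<in>frontier \<Omega>. ereal (pos_part u x))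
        + ereal C * enn2ereal (ennreal_powr
            (Lnorm (real CARD('n)) (upper_contact_set \<Omega> u) (neg_part f)) (1 / (1 + p)))"
proof (rule slope_bound[OF p d, where 'n = 'n])
  let ?n = "real CARD('n)"
  fix A :: real
  assume A: "0 < A" and slope:
    "\<And>(\<Omega> :: (real ^ 'n) set) f u (R :: real) x0 K.
      \<lbrakk>open \<Omega>; bounded \<Omega>; diameter \<Omega> = d; continuous_on \<Omega> f; continuous_on (closure \<Omega>) u;
        visc_plus_ge p l L \<Omega> f u; 0 < R; x0 \<in> \<Omega>;
        \<And>y. y \<in> frontier \<Omega> \<Longrightarrow> u y + 2 * real CARD('n) * R * d < u x0;
        0 \<le> K; (\<integral>\<^sup>+x\<in>upper_contact_set \<Omega> u. ennreal (neg_part f x ^ CARD('n)) \<partial>lborel) = ennreal K\<rbrakk> \<Longrightarrow>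
      R \<le> A * K powr (1 / (real CARD('n) * (1 + p)))"
  define C where "C = 2 * ?n * d * A"
  have C: "0 < C" using A d by (simp add: C_def)
  have main: "(SUP x\<in>\<Omega>. ereal (u x)) \<le> (SUP x\<in>frontier \<Omega>. ereal (pos_part u x))
        + ereal C * enn2ereal (ennreal_powr
            (Lnorm ?n (upper_contact_set \<Omega> u) (neg_part f)) (1 / (1 + p)))"
    if \<Omega>: "open \<Omega>" "\<Omega> \<noteq> {}" "bounded \<Omega>" "diameter \<Omega> = d" and f: "continuous_on \<Omega> f"
      and u: "continuous_on (closure \<Omega>) u" and visc: "visc_plus_ge p l L \<Omega> f u"
    for \<Omega> :: "(real ^ 'n) set" and f u
  proof -
    define I where "I = (\<integral>\<^sup>+x\<in>upper_contact_set \<Omega> u. ennreal (neg_part f x ^ CARD('n)) \<partial>lborel)"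
    define b where "b = (SUP x\<in>frontier \<Omega>. ereal (pos_part u x))"
    \<comment> \<open>At base 0 both sides vanish because the exponent is positive; at a positive
      base \<open>powr\<close> agrees with the natural power.\<close>
    have "\<bar>neg_part f x\<bar> powr ?n = neg_part f x ^ CARD('n)" for x
      by (cases "neg_part f x = 0") (auto simp: neg_part_def powr_realpow)
    then have Lnorm: "Lnorm ?n (upper_contact_set \<Omega> u) (neg_part f) = ennreal_powr I (1 / ?n)"
      by (simp add: Lnorm_def I_def)
    show ?thesis
    proof (cases "I = \<infinity>")
      case True
      \<comment> \<open>An infinite norm makes the right-hand side infinite, since \<open>C\<close>
        is positive.\<close>
      then show ?thesis using C by (simp add: Lnorm ennreal_powr_def)
    next
      case False
      define K where "K = enn2real I"
      have K: "0 \<le> K" "I = ennreal K"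
        using False by (simp_all add: K_def less_top)
      define \<kappa> where "\<kappa> = K powr (1 / (?n * (1 + p)))"
      have \<kappa>: "0 \<le> \<kappa>" by (simp add: \<kappa>_def)
      have norm_eq: "enn2ereal (ennreal_powr (Lnorm ?n (upper_contact_set \<Omega> u) (neg_part f)) (1 / (1 + p))) = ereal \<kappa>"
        using K(1) by (simp add: Lnorm ennreal_powr_def K(2) powr_powr \<kappa>_def)
      have "ereal (u x0) \<le> b + ereal (C * \<kappa>)" if x0: "x0 \<in> \<Omega>" for x0
      proof (rule ccontr)
        assume "\<not> ?thesis"
        then have less: "b + ereal (C * \<kappa>) < ereal (u x0)" by simp
        \<comment> \<open>A nonempty bounded set has a nonempty frontier, so \<open>b\<close> is
          nonnegative and not the value \<open>-\<infinity>\<close> of an empty supremum;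
          \<open>less\<close> excludes \<open>\<infinity>\<close>.\<close>
        have "\<Omega> \<noteq> UNIV" using \<Omega>(3) not_bounded_UNIV by auto
        then obtain y0 where "y0 \<in> frontier \<Omega>"
          using \<Omega>(2) by (metis equals0I frontier_eq_empty)
        then have "ereal (pos_part u y0) \<le> b" unfolding b_def by (intro SUP_upper)
        then have "0 \<le> b" by (rule order_trans[rotated]) (simp add: pos_part_def le_max_iff_disj)
        then obtain b' where b': "b = ereal b'"
          using less by (cases b) auto
        have u_le: "u y \<le> b'" if "y \<in> frontier \<Omega>" for y
        proof -
          have "ereal (pos_part u y) \<le> b" unfolding b_def using that by (intro SUP_upper)
          then show ?thesis by (simp add: b' pos_part_def)
        qed
        have "A * \<kappa> < (u x0 - b') / (2 * ?n * d)"
          using less d by (simp add: b' C_def field_simps)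
        then obtain R where R: "A * \<kappa> < R" "R < (u x0 - b') / (2 * ?n * d)"
          using dense by blast
        have "0 \<le> A * \<kappa>" using A \<kappa> by simp
        with R(1) have "0 < R" by linarith
        have "2 * ?n * R * d < u x0 - b'" using R(2) d by (simp add: field_simps)
        then have "u y + 2 * ?n * R * d < u x0" if "y \<in> frontier \<Omega>" for y
          using u_le[OF that] by linarith
        from slope[OF \<Omega>(1,3,4) f u visc \<open>0 < R\<close> x0 this K(1)] K(2)
        have "R \<le> A * \<kappa>" by (simp add: I_def \<kappa>_def)
        with R(1) show False by simp
      qed
      then show ?thesis
        unfolding norm_eq b_def[symmetric] by (intro SUP_least) simp
    qed
  qed
  show ?thesis using C main by (intro exI[of _ C]) blast
qed

theorem theorem1p1:
  fixes p l L d :: real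
  assumes "p \<ge> 0" and "0 < l" and "l \<le> L" and "d > 0"
  shows "\<exists>C::real. C > 0 \<and>
    (\<forall>(\<Omega> :: (real ^ 'n) set) f u.
       open \<Omega> \<and> connected \<Omega> \<and> \<Omega> \<noteq> {} \<and> bounded \<Omega> \<and> diameter \<Omega> = d \<and>
       continuous_on \<Omega> f \<and> continuous_on (closure \<Omega>) u \<longrightarrow>
         (visc_plus_ge p l L \<Omega> f u \<longrightarrow>
            (SUP x\<in>\<Omega>. ereal (u x))
              \<le> (SUP x\<in>frontier \<Omega>. ereal (pos_part u x))
                + ereal C * enn2ereal (ennreal_powr
                    (Lnorm (real CARD('n)) (upper_contact_set \<Omega> u) (neg_part f)) (1 / (1 + p)))) \<and>
         (visc_minus_le p l L \<Omega> f u \<longrightarrow>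
            (SUP x\<in>\<Omega>. ereal (neg_part u x))
              \<le> (SUP x\<in>frontier \<Omega>. ereal (neg_part u x))
                + ereal C * enn2ereal (ennreal_powr
                    (Lnorm (real CARD('n)) (upper_contact_set \<Omega> (\<lambda>x. - u x)) (pos_part f)) (1 / (1 + p)))))"
proof -
  obtain C where C: "C > 0" and main: "\<And>(\<Omega> :: (real ^ 'n) set) f u.
    \<lbrakk>open \<Omega>; \<Omega> \<noteq> {}; bounded \<Omega>; diameter \<Omega> = d; continuous_on \<Omega> f; continuous_on (closure \<Omega>) u;
      visc_plus_ge p l L \<Omega> f u\<rbrakk> \<Longrightarrow>
      (SUP x\<in>\<Omega>. ereal (u x)) \<le> (SUP x\<in>frontier \<Omega>. ereal (pos_part u x))
        + ereal C * enn2ereal (ennreal_powr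
            (Lnorm (real CARD('n)) (upper_contact_set \<Omega> u) (neg_part f)) (1 / (1 + p)))"
    using sup_bound[OF assms, where 'n = 'n] by blast
  \<comment> \<open>Part (ii) is part (i) applied to \<open>-u\<close> and \<open>-f\<close>, whose
    positive and negative parts are those of \<open>u\<close> and \<open>f\<close>
    interchanged.\<close>
  have minus: "(SUP x\<in>\<Omega>. ereal (neg_part u x))
      \<le> (SUP x\<in>frontier \<Omega>. ereal (neg_part u x))
        + ereal C * enn2ereal (ennreal_powr
            (Lnorm (real CARD('n)) (upper_contact_set \<Omega> (\<lambda>x. - u x)) (pos_part f)) (1 / (1 + p)))"
      (is "_ \<le> ?b + ?r")
    if \<Omega>: "open \<Omega>" "\<Omega> \<noteq> {}" "bounded \<Omega>" "diameter \<Omega> = d"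
      and f: "continuous_on \<Omega> f" and u: "continuous_on (closure \<Omega>) u"
      and visc: "visc_minus_le p l L \<Omega> f u"
    for \<Omega> :: "(real ^ 'n) set" and f u
  proof -
    have parts: "pos_part (\<lambda>x. - u x) = neg_part u" "neg_part (\<lambda>x. - f x) = pos_part f"
      by (simp_all add: fun_eq_iff pos_part_def neg_part_def)
    have le: "(SUP x\<in>\<Omega>. ereal (- u x)) \<le> ?b + ?r"
      using main[OF \<Omega> continuous_on_minus[OF f] continuous_on_minus[OF u]
          visc_minus_le_imp_visc_plus_ge_uminus[OF visc]]
      by (simp only: parts)
    \<comment> \<open>Part (i) bounds only \<open>-u\<close>. To pass to \<open>neg_part u\<close>,
      the maximum of \<open>-u\<close> and 0, the right-hand side must be nonnegative, which follows
      from a point on the frontier.\<close>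
    have "\<Omega> \<noteq> UNIV" using \<Omega>(3) not_bounded_UNIV by auto
    then obtain y0 where "y0 \<in> frontier \<Omega>"
      using \<Omega>(2) by (metis equals0I frontier_eq_empty)
    then have "ereal (neg_part u y0) \<le> ?b" by (intro SUP_upper)
    then have "0 \<le> ?b" by (rule order_trans[rotated]) (simp add: neg_part_def le_max_iff_disj)
    moreover have "0 \<le> ?r" using C by simp
    ultimately have "0 \<le> ?b + ?r" by simp
    moreover have "ereal (- u x) \<le> ?b + ?r" if "x \<in> \<Omega>" for x
      using SUP_upper[OF that, of "\<lambda>x. ereal (- u x)"] le by (rule order_trans)
    moreover have "ereal (neg_part u x) = 0 \<or> ereal (neg_part u x) = ereal (- u x)" for x
      by (auto simp: neg_part_def max_def)
    ultimately show ?thesis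
      by (intro SUP_least) metis
  qed
  show ?thesis using C main minus by (intro exI[of _ C]) blast
qed

end
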